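(* In the setting and notation of the context, let $l\in\{+1,-1\}$ and let $\Gamma_l$ be a contour as described there. Suppose $Z_{\triangleright}\in\mathcal B(\mathcal H_A)$ satisfies $\operatorname{dist}(\sigma(Z_{\triangleright}),\Gamma_l)>0$ and is a solution of $$Z=\widetilde A+V^{\triangleright}_{\Gamma_l}(Z).$$ If $u\in\mathcal H_A$ is an eigenvector of $Z_{\triangleright}$, $Z_{\triangleright}u=zu$ with $z\in\sigma(Z_{\triangleright})$, then $zu=\widetilde Au+V_{\Gamma_l}(z)u$, that is, $M_{\Gamma_l}(z)u=0$. Hence any eigenvalue $z$ of $Z_{\triangleright}$ is an eigenvalue of the analytically continued transfer function $M_{\Gamma_l}(\cdot)$, and $u$ is a corresponding eigenvector.
   Context: **Operators.** $\mathcal H_A,\mathcal H_C$ are separable Hilbert spaces; $\mathcal B(\cdot)$ denotes bounded operators. $C$ is a (possibly unbounded) self-adjoint operator in $\mathcal H_C$ with $C\ge\lambda_C>0$, whose spectrum is absolutely continuous and equals $[\lambda_C,+\infty)$. $A\in\mathcal B(\mathcal H_A)$ is not necessarily self-adjoint. $D$ is a densely defined closable operator from $\operatorname{dom}(D)\subset\mathcal H_A$ to $\mathcal H_C$ such that $C^{-1/2}D$ extends to a bounded operator $\widetilde D=\overline{C^{-1/2}D}\in\mathcal B(\mathcal H_A,\mathcal H_C)$. $B$ is a densely defined closable operator from $\operatorname{dom}(B)\subset\mathcal H_C$ to $\mathcal H_A$ with $\operatorname{dom}(B)\supset\operatorname{dom}(C^{1/2})$; then $\widetilde B=BC^{-1/2}\in\mathcal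 B(\mathcal H_C,\mathcal H_A)$. Put $\widetilde A=A-\widetilde B\widetilde D$. **Numerical range.** $\nu(\widetilde A)=\overline{\{\langle\widetilde Ax,x\rangle: x\in\mathcal H_A,\ \|x\|=1\}}$ is assumed to lie in $\mathcal O_\eta([\alpha_1,\alpha_2])=\{z\in\mathbb C:\operatorname{dist}(z,[\alpha_1,\alpha_2])\le\eta\}$ for some $\eta>0$ and real $\alpha_1<\alpha_2$ with $\alpha_1-\eta>\lambda_C$. **The function $K$.** Let $\{E_C(\mu)\}_{\mu\in\mathbb R}$ be the spectral family of $C$ and $K(\mu)=\widetilde BE_C(\mu)\widetilde D$. It is assumed that $K$ is continuously differentiable on $(\lambda_C,+\infty)$ in the operator norm topology and that it admits an analytic continuation (again denoted $K$, with derivative $K'$) from $(\lambda_C,\beta)$, where $\beta>\alpha_2+\eta$, to a simply connected domain $\mathcal D\subset\mathbb C$ with $\mathcal D\supset\mathcal O_\eta([\alpha_1,\alpha_2])$; that at the points $\lambda=\lambda_C$ and $\lambda=\beta$ it satisfies $\|K'(\mu)\|\le c|\mu-\lambda|^\gamma$, $\mu\in\mathcal D$, with some $c>0$, $\gamma\in(-1,0]$; and that $\int_\beta^\infty(1+|\mu|)^{-1}\|K'(\mu)\|\,d\mu<\infty$. **Contours.** $\mathcal D^{(\pm1)}=\mathcal D\cap\mathbb C^{\pm}$ (open upper/lower half-planes). For $l=\pm1$ we consider contours $\Gamma_l=\widetilde\Gamma_l\cup[\beta,+\infty)$, where $\widetilde\Gamma_l$ is a rectifiable Jordan curve in $\mathcal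 D^{(l)}$ resulting from continuous deformation of the interval $(\lambda_C,\beta)$ with the end points kept fixed; $\Gamma_l$ is traversed from $\lambda_C$ to $+\infty$. **Transfer function.** $M_{\Gamma_l}(z)=\widetilde A-z+V_{\Gamma_l}(z)$, $V_{\Gamma_l}(z)=\int_{\Gamma_l}d\mu\,K'(\mu)\frac{z}{z-\mu}$, for $z\in\mathbb C\setminus\Gamma_l$. A number $z\in\mathbb C\setminus\Gamma_l$ is an eigenvalue of $M_{\Gamma_l}(\cdot)$ with eigenvector $u\ne0$ if $M_{\Gamma_l}(z)u=0$. **Transformation.** For $Z\in\mathcal B(\mathcal H_A)$ with spectrum satisfying $\operatorname{dist}(\sigma(Z),\Gamma_l)>0$, $$V^{\triangleright}_{\Gamma_l}(Z)=\int_{\Gamma_l}d\mu\,K'(\mu)Z(Z-\mu)^{-1}.$$ *)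

theory Defs
  imports "HOL-Analysis.Analysis"
begin

section \<open>Complex normed spaces and Hilbert spaces\<close>

class scaleC =
  fixes scaleC :: "complex \<Rightarrow> 'a \<Rightarrow> 'a" (infixr "*\<^sub>C" 75)

class complex_normed_vector = real_normed_vector + scaleC +
  assumes scaleC_add_right: "c *\<^sub>C (x + y) = c *\<^sub>C x + c *\<^sub>C y"
    and scaleC_add_left: "(c + d) *\<^sub>C x = c *\<^sub>C x + d *\<^sub>C x"
    and scaleC_scaleC: "c *\<^sub>C (d *\<^sub>C x) = (c * d) *\<^sub>C x"
    and scaleC_of_real: "complex_of_real r *\<^sub>C x = r *\<^sub>R x"
    and norm_scaleC: "norm (c *\<^sub>C x) = cmod c * norm x"

class complex_banach = complex_normed_vector + complete_space

subclass (in complex_banach) banach ..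

text \<open>The inner product is linear in its first argument.\<close>

class complex_hilbert_space = complex_banach +
  fixes cinner :: "'a \<Rightarrow> 'a \<Rightarrow> complex"
  assumes cinner_commute: "cinner x y = cnj (cinner y x)"
    and cinner_add_left: "cinner (x + y) z = cinner x z + cinner y z"
    and cinner_scaleC_left: "cinner (c *\<^sub>C x) y = c * cinner x y"
    and norm_eq_sqrt_cinner: "norm x = sqrt (Re (cinner x x))"

instantiation complex :: complex_hilbert_space
begin

definition scaleC_complex :: "complex \<Rightarrow> complex \<Rightarrow> complex"
  where "scaleC_complex c x = c * x"

definition cinner_complex :: "complex \<Rightarrow> complex \<Rightarrow> complex"
  where "cinner_complex x y = x * cnj y"

instance
proof
  fix x y z c d :: complex and r :: real
  show "c *\<^sub>C (x + y) = c *\<^sub>C x + c *\<^sub>C y" "(c + d) *\<^sub>C x = c *\<^sub>C x + d *\<^sub>C x"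
    "c *\<^sub>C d *\<^sub>C x = (c * d) *\<^sub>C x" "norm (c *\<^sub>C x) = cmod c * norm x"
    by (simp_all add: scaleC_complex_def algebra_simps norm_mult)
  show "complex_of_real r *\<^sub>C x = r *\<^sub>R x"
    by (simp add: scaleC_complex_def scaleR_conv_of_real)
  show "cinner x y = cnj (cinner y x)" "cinner (x + y) z = cinner x z + cinner y z"
    "cinner (c *\<^sub>C x) y = c * cinner x y"
    by (simp_all add: cinner_complex_def scaleC_complex_def algebra_simps)
  show "norm x = sqrt (Re (cinner x x))"
    by (simp add: cinner_complex_def cmod_def power2_eq_square)
qed

end

lemma bounded_linear_scaleC_right: "bounded_linear (\<lambda>x::'a::complex_normed_vector. c *\<^sub>C x)"
proof (rule bounded_linear_intro[where K = "cmod c"])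
  fix x y :: 'a and r :: real
  show "c *\<^sub>C (x + y) = c *\<^sub>C x + c *\<^sub>C y" by (rule scaleC_add_right)
  show "c *\<^sub>C (r *\<^sub>R x) = r *\<^sub>R (c *\<^sub>C x)"
    by (simp flip: scaleC_of_real add: scaleC_scaleC mult.commute)
  show "norm (c *\<^sub>C x) \<le> norm x * cmod c" by (simp add: norm_scaleC mult.commute)
qed


section \<open>Bounded complex-linear operators\<close>

typedef (overloaded) ('a, 'b) bop ("(_ \<Rightarrow>\<^sub>B /_)" [22, 21] 21) =
  "{T :: 'a::complex_normed_vector \<Rightarrow>\<^sub>L 'b::complex_normed_vector.
      \<forall>c x. blinfun_apply T (c *\<^sub>C x) = c *\<^sub>C blinfun_apply T x}"
  morphisms bop_blinfun Bop
proof -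
  have "c *\<^sub>C (0::'b) = 0" for c
    by (metis norm_eq_zero norm_scaleC mult_zero_right)
  then show ?thesis
    by (intro exI[of _ 0]) simp
qed

setup_lifting type_definition_bop

lift_definition bop_apply :: "('a::complex_normed_vector \<Rightarrow>\<^sub>B 'b::complex_normed_vector) \<Rightarrow> 'a \<Rightarrow> 'b"
  is blinfun_apply .

lemma scaleC_minus_right: "c *\<^sub>C (- x) = - (c *\<^sub>C (x::'a::complex_normed_vector))"
  by (rule linear_neg[OF bounded_linear.linear[OF bounded_linear_scaleC_right]])

lemma scaleC_diff_right: "c *\<^sub>C (x - y) = c *\<^sub>C x - c *\<^sub>C (y::'a::complex_normed_vector)"
  by (rule linear_diff[OF bounded_linear.linear[OF bounded_linear_scaleC_right]])

lemma scaleC_zero_right: "c *\<^sub>C (0::'a::complex_normed_vector) = 0"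
  by (rule linear_0[OF bounded_linear.linear[OF bounded_linear_scaleC_right]])

lemma scaleC_scaleR_right: "c *\<^sub>C (r *\<^sub>R x) = r *\<^sub>R (c *\<^sub>C (x::'a::complex_normed_vector))"
  by (rule linear_scale[OF bounded_linear.linear[OF bounded_linear_scaleC_right]])

instantiation bop :: (complex_normed_vector, complex_normed_vector) complex_normed_vector
begin

lift_definition norm_bop :: "'a \<Rightarrow>\<^sub>B 'b \<Rightarrow> real" is norm .

lift_definition minus_bop :: "'a \<Rightarrow>\<^sub>B 'b \<Rightarrow> 'a \<Rightarrow>\<^sub>B 'b \<Rightarrow> 'a \<Rightarrow>\<^sub>B 'b" is "(-)"
  by (simp add: blinfun.diff_left scaleC_diff_right)

lift_definition uminus_bop :: "'a \<Rightarrow>\<^sub>B 'b \<Rightarrow> 'a \<Rightarrow>\<^sub>B 'b" is uminus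
  by (simp add: blinfun.minus_left scaleC_minus_right)

lift_definition zero_bop :: "'a \<Rightarrow>\<^sub>B 'b" is 0
  by (simp add: scaleC_zero_right)

lift_definition plus_bop :: "'a \<Rightarrow>\<^sub>B 'b \<Rightarrow> 'a \<Rightarrow>\<^sub>B 'b \<Rightarrow> 'a \<Rightarrow>\<^sub>B 'b" is "(+)"
  by (simp add: blinfun.add_left scaleC_add_right)

lift_definition scaleR_bop :: "real \<Rightarrow> 'a \<Rightarrow>\<^sub>B 'b \<Rightarrow> 'a \<Rightarrow>\<^sub>B 'b" is scaleR
  by (simp add: blinfun.scaleR_left scaleC_scaleR_right)

lift_definition scaleC_bop :: "complex \<Rightarrow> 'a \<Rightarrow>\<^sub>B 'b \<Rightarrow> 'a \<Rightarrow>\<^sub>B 'b"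
  is "\<lambda>c T. Blinfun (\<lambda>x. c *\<^sub>C blinfun_apply T x)"
  by (subst (1 2) bounded_linear_Blinfun_apply)
    (auto intro!: bounded_linear_compose[OF bounded_linear_scaleC_right] bounded_linear_blinfun_apply
      simp: scaleC_scaleC mult.commute)

definition dist_bop :: "'a \<Rightarrow>\<^sub>B 'b \<Rightarrow> 'a \<Rightarrow>\<^sub>B 'b \<Rightarrow> real"
  where "dist_bop S T = norm (S - T)"

definition uniformity_bop :: "(('a \<Rightarrow>\<^sub>B 'b) \<times> ('a \<Rightarrow>\<^sub>B 'b)) filter"
  where "uniformity_bop = (INF e\<in>{0 <..}. principal {(x, y). dist x y < e})"

definition open_bop :: "('a \<Rightarrow>\<^sub>B 'b) set \<Rightarrow> bool"
  where "open_bop S = (\<forall>x\<in>S. \<forall>\<^sub>F (x', y) in uniformity. x' = x \<longrightarrow> y \<in> S)"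

definition sgn_bop :: "'a \<Rightarrow>\<^sub>B 'b \<Rightarrow> 'a \<Rightarrow>\<^sub>B 'b"
  where "sgn_bop T = inverse (norm T) *\<^sub>R T"

lemma blinfun_scaleC_apply:
  "blinfun_apply (Blinfun (\<lambda>x. c *\<^sub>C blinfun_apply T x)) x = c *\<^sub>C blinfun_apply T x"
  for T :: "'a \<Rightarrow>\<^sub>L 'b"
  by (subst bounded_linear_Blinfun_apply)
    (auto intro!: bounded_linear_compose[OF bounded_linear_scaleC_right] bounded_linear_blinfun_apply)

lemma norm_blinfun_scaleC_le:
  "norm (Blinfun (\<lambda>x. c *\<^sub>C blinfun_apply T x)) \<le> cmod c * norm T"
  for T :: "'a \<Rightarrow>\<^sub>L 'b"
  by (rule norm_blinfun_bound)
    (auto simp: blinfun_scaleC_apply norm_scaleC mult.assoc intro!: mult_left_mono norm_blinfun)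

lemma norm_blinfun_scaleC:
  "norm (Blinfun (\<lambda>x. c *\<^sub>C blinfun_apply T x)) = cmod c * norm T"
  for T :: "'a \<Rightarrow>\<^sub>L 'b"
proof (cases "c = 0")
  case True
  with norm_blinfun_scaleC_le[of c T] show ?thesis by simp
next
  case False
  let ?S = "Blinfun (\<lambda>x. c *\<^sub>C blinfun_apply T x)"
  have one: "1 *\<^sub>C y = y" for y :: 'b
    using scaleC_of_real[of 1 y] by simp
  have "norm (blinfun_apply T x) \<le> (norm ?S / cmod c) * norm x" for x
  proof -
    have "cmod c * norm (blinfun_apply T x) = norm (blinfun_apply ?S x)"
      by (simp only: blinfun_scaleC_apply norm_scaleC)
    also have "\<dots> \<le> norm ?S * norm x" by (rule norm_blinfun)
    finally show ?thesis using False by (simp add: field_simps)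
  qed
  then have "norm T \<le> norm ?S / cmod c"
    by (intro norm_blinfun_bound) auto
  then have "cmod c * norm T \<le> norm ?S"
    using False by (simp add: field_simps)
  with norm_blinfun_scaleC_le[of c T] show ?thesis by linarith
qed

instance
proof
  fix S T U :: "'a \<Rightarrow>\<^sub>B 'b" and a b :: real and c d :: complex
  show "dist S T = norm (S - T)" by (rule dist_bop_def)
  show "sgn T = inverse (norm T) *\<^sub>R T" by (rule sgn_bop_def)
  show "(uniformity :: (('a \<Rightarrow>\<^sub>B 'b) \<times> ('a \<Rightarrow>\<^sub>B 'b)) filter) =
      (INF e\<in>{0 <..}. principal {(x, y). dist x y < e})"
    by (rule uniformity_bop_def)
  show "open W = (\<forall>x\<in>W. \<forall>\<^sub>F (x', y) in uniformity. x' = x \<longrightarrow> y \<in> W)" for W :: "('a \<Rightarrow>\<^sub>B 'b) set"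
    by (rule open_bop_def)
  show "S + T + U = S + (T + U)" "S + T = T + S" "0 + S = S" "- S + S = 0" "S - T = S + - T"
    by (transfer, simp)+
  show "a *\<^sub>R (S + T) = a *\<^sub>R S + a *\<^sub>R T"
    by transfer (rule scaleR_add_right)
  show "(a + b) *\<^sub>R S = a *\<^sub>R S + b *\<^sub>R S"
    by transfer (rule scaleR_add_left)
  show "a *\<^sub>R b *\<^sub>R S = (a * b) *\<^sub>R S"
    by transfer (rule scaleR_scaleR)
  show "1 *\<^sub>R S = S"
    by transfer (rule scaleR_one)
  show "(norm S = 0) = (S = 0)"
    by transfer (rule norm_eq_zero)
  show "norm (S + T) \<le> norm S + norm T"
    by transfer (rule norm_triangle_ineq)
  show "norm (a *\<^sub>R S) = \<bar>a\<bar> * norm S"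
    by transfer (rule norm_scaleR)
  show "c *\<^sub>C (S + T) = c *\<^sub>C S + c *\<^sub>C T"
    by transfer (rule blinfun_eqI, subst blinfun_scaleC_apply, simp only: blinfun_scaleC_apply blinfun.add_left scaleC_add_right)
  show "(c + d) *\<^sub>C S = c *\<^sub>C S + d *\<^sub>C S"
    by transfer (rule blinfun_eqI, subst blinfun_scaleC_apply, simp only: blinfun_scaleC_apply blinfun.add_left scaleC_add_left)
  show "c *\<^sub>C (d *\<^sub>C S) = (c * d) *\<^sub>C S"
    by transfer (rule blinfun_eqI, subst blinfun_scaleC_apply, simp only: blinfun_scaleC_apply scaleC_scaleC)
  show "complex_of_real a *\<^sub>C S = a *\<^sub>R S"
    by transfer (rule blinfun_eqI, subst blinfun_scaleC_apply, simp only: blinfun_scaleC_apply blinfun.scaleR_left scaleC_of_real)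
  show "norm (c *\<^sub>C S) = cmod c * norm S"
    by (transfer, rule norm_blinfun_scaleC)
qed

end

instance bop :: (complex_normed_vector, complex_banach) complex_banach
proof
  fix X :: "nat \<Rightarrow> 'a \<Rightarrow>\<^sub>B 'b"
  assume X: "Cauchy X"
  have dist: "dist (bop_blinfun S) (bop_blinfun T) = dist S T" for S T :: "'a \<Rightarrow>\<^sub>B 'b"
    unfolding dist_norm by transfer simp
  have "Cauchy (\<lambda>n. bop_blinfun (X n))"
    using X unfolding Cauchy_def dist .
  then obtain L where L: "(\<lambda>n. bop_blinfun (X n)) \<longlonglongrightarrow> L"
    using Cauchy_convergent convergent_def by blast
  have lim: "(\<lambda>n. blinfun_apply (bop_blinfun (X n)) x) \<longlonglongrightarrow> blinfun_apply L x" for x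
    by (intro tendsto_intros L)
  have "blinfun_apply L (c *\<^sub>C x) = c *\<^sub>C blinfun_apply L x" for c x
  proof (rule LIMSEQ_unique[OF lim])
    have "(\<lambda>n. c *\<^sub>C blinfun_apply (bop_blinfun (X n)) x) \<longlonglongrightarrow> c *\<^sub>C blinfun_apply L x"
      by (rule bounded_linear.tendsto[OF bounded_linear_scaleC_right lim])
    moreover have "blinfun_apply (bop_blinfun (X n)) (c *\<^sub>C x) =
        c *\<^sub>C blinfun_apply (bop_blinfun (X n)) x" for n
      using bop_blinfun[of "X n"] by simp
    ultimately show "(\<lambda>n. blinfun_apply (bop_blinfun (X n)) (c *\<^sub>C x)) \<longlonglongrightarrow>
        c *\<^sub>C blinfun_apply L x"
      by simp
  qed
  then have "bop_blinfun (Bop L) = L"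
    by (simp add: Bop_inverse)
  with L have "X \<longlonglongrightarrow> Bop L"
    unfolding tendsto_iff dist[symmetric] by simp
  then show "convergent X" by (rule convergentI)
qed

lift_definition bop_id :: "'a::complex_normed_vector \<Rightarrow>\<^sub>B 'a" is id_blinfun
  by simp

lift_definition bop_compose ::
  "('b::complex_normed_vector \<Rightarrow>\<^sub>B 'c::complex_normed_vector) \<Rightarrow>
   ('a::complex_normed_vector \<Rightarrow>\<^sub>B 'b) \<Rightarrow> ('a \<Rightarrow>\<^sub>B 'c)" (infixl "o\<^sub>B" 67)
  is blinfun_compose
  by simp

definition bop_inverse :: "('a::complex_normed_vector \<Rightarrow>\<^sub>B 'a) \<Rightarrow> ('a \<Rightarrow>\<^sub>B 'a)"
  where "bop_inverse T = (THE R. R o\<^sub>B T = bop_id \<and> T o\<^sub>B R = bop_id)"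


section \<open>Unbounded operators\<close>

text \<open>An operator with domain \<open>S\<close> is a total function whose values outside \<open>S\<close> are
  irrelevant; a bounded operator has domain \<^term>\<open>UNIV\<close>.\<close>

definition csubspace :: "'a::complex_normed_vector set \<Rightarrow> bool"
  where "csubspace S \<longleftrightarrow>
    0 \<in> S \<and> (\<forall>x\<in>S. \<forall>y\<in>S. x + y \<in> S) \<and> (\<forall>c. \<forall>x\<in>S. c *\<^sub>C x \<in> S)"

definition linear_op :: "'a::complex_normed_vector set \<Rightarrow> ('a \<Rightarrow> 'b::complex_normed_vector) \<Rightarrow> bool"
  where "linear_op S T \<longleftrightarrow> csubspace S \<and>
    (\<forall>x\<in>S. \<forall>y\<in>S. T (x + y) = T x + T y) \<and> (\<forall>c. \<forall>x\<in>S. T (c *\<^sub>C x) = c *\<^sub>C T x)"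

definition densely_defined_op ::
  "'a::complex_normed_vector set \<Rightarrow> ('a \<Rightarrow> 'b::complex_normed_vector) \<Rightarrow> bool"
  where "densely_defined_op S T \<longleftrightarrow> linear_op S T \<and> closure S = UNIV"

text \<open>The closure of the graph is again a graph.\<close>

definition closable_op ::
  "'a::complex_normed_vector set \<Rightarrow> ('a \<Rightarrow> 'b::complex_normed_vector) \<Rightarrow> bool"
  where "closable_op S T \<longleftrightarrow>
    (\<forall>x y y'. (x, y) \<in> closure ((\<lambda>x. (x, T x)) ` S) \<and>
       (x, y') \<in> closure ((\<lambda>x. (x, T x)) ` S) \<longrightarrow> y = y')"

text \<open>The second conjunct says that the graphs of \<open>T\<close> and of its adjoint coincide.\<close>

definition self_adjoint_op :: "'a::complex_hilbert_space set \<Rightarrow> ('a \<Rightarrow> 'a) \<Rightarrow> bool"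
  where "self_adjoint_op S T \<longleftrightarrow> densely_defined_op S T \<and>
    (\<forall>y w. (y \<in> S \<and> T y = w) \<longleftrightarrow> (\<forall>x\<in>S. cinner (T x) y = cinner x w))"

definition resolvent_set :: "'a::complex_normed_vector set \<Rightarrow> ('a \<Rightarrow> 'a) \<Rightarrow> complex set"
  where "resolvent_set S T =
    {z. \<exists>R :: 'a \<Rightarrow>\<^sub>B 'a.
        (\<forall>y. bop_apply R y \<in> S \<and> T (bop_apply R y) - z *\<^sub>C bop_apply R y = y) \<and>
        (\<forall>x\<in>S. bop_apply R (T x - z *\<^sub>C x) = x)}"

definition spectrum :: "'a::complex_normed_vector set \<Rightarrow> ('a \<Rightarrow> 'a) \<Rightarrow> complex set"
  where "spectrum S T = - resolvent_set S T"

abbreviation bop_spectrum :: "('a::complex_normed_vector \<Rightarrow>\<^sub>B 'a) \<Rightarrow> complex set"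
  where "bop_spectrum T \<equiv> spectrum UNIV (bop_apply T)"

definition numerical_range :: "('a::complex_hilbert_space \<Rightarrow>\<^sub>B 'a) \<Rightarrow> complex set"
  where "numerical_range T = closure {cinner (bop_apply T x) x |x. norm x = 1}"


section \<open>Spectral families\<close>

definition orthogonal_projection :: "('a::complex_hilbert_space \<Rightarrow>\<^sub>B 'a) \<Rightarrow> bool"
  where "orthogonal_projection P \<longleftrightarrow> P o\<^sub>B P = P \<and>
    (\<forall>x y. cinner (bop_apply P x) y = cinner x (bop_apply P y))"

definition spectral_family :: "(real \<Rightarrow> 'a::complex_hilbert_space \<Rightarrow>\<^sub>B 'a) \<Rightarrow> bool"
  where "spectral_family E \<longleftrightarrow>
    (\<forall>\<mu>. orthogonal_projection (E \<mu>)) \<and>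
    (\<forall>\<mu> \<nu>. E \<mu> o\<^sub>B E \<nu> = E (min \<mu> \<nu>)) \<and>
    (\<forall>x \<mu>. ((\<lambda>\<nu>. bop_apply (E \<nu>) x) \<longlongrightarrow> bop_apply (E \<mu>) x) (at_right \<mu>)) \<and>
    (\<forall>x. ((\<lambda>\<nu>. bop_apply (E \<nu>) x) \<longlongrightarrow> 0) at_bot) \<and>
    (\<forall>x. ((\<lambda>\<nu>. bop_apply (E \<nu>) x) \<longlongrightarrow> x) at_top)"

text \<open>The Stieltjes measure \<open>d\<langle>E(\<mu>)x, x\<rangle>\<close>.\<close>

definition spectral_measure :: "(real \<Rightarrow> 'a::complex_hilbert_space \<Rightarrow>\<^sub>B 'a) \<Rightarrow> 'a \<Rightarrow> real measure"
  where "spectral_measure E x = interval_measure (\<lambda>\<mu>. Re (cinner (bop_apply (E \<mu>) x) x))"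

text \<open>The domain of \<open>\<phi>(C) = \<integral> \<phi>(\<mu>) dE(\<mu>)\<close>.\<close>

definition spectral_domain ::
  "(real \<Rightarrow> 'a::complex_hilbert_space \<Rightarrow>\<^sub>B 'a) \<Rightarrow> (real \<Rightarrow> real) \<Rightarrow> 'a set"
  where "spectral_domain E \<phi> = {x. integrable (spectral_measure E x) (\<lambda>\<mu>. (\<phi> \<mu>)\<^sup>2)}"

text \<open>The linear operator \<open>T\<close> on \<open>S\<close> is \<open>\<integral> \<phi>(\<mu>) dE(\<mu>)\<close>. By polarization it is enough to
  prescribe its quadratic form.\<close>

definition is_spectral_integral ::
  "(real \<Rightarrow> 'a::complex_hilbert_space \<Rightarrow>\<^sub>B 'a) \<Rightarrow> (real \<Rightarrow> real) \<Rightarrow> 'a set \<Rightarrow> ('a \<Rightarrow> 'a) \<Rightarrow> bool"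
  where "is_spectral_integral E \<phi> S T \<longleftrightarrow>
    linear_op S T \<and> S = spectral_domain E \<phi> \<and>
    (\<forall>x\<in>S. cinner (T x) x = complex_of_real (integral\<^sup>L (spectral_measure E x) \<phi>))"

definition spectral_family_of ::
  "(real \<Rightarrow> 'a::complex_hilbert_space \<Rightarrow>\<^sub>B 'a) \<Rightarrow> 'a set \<Rightarrow> ('a \<Rightarrow> 'a) \<Rightarrow> bool"
  where "spectral_family_of E S T \<longleftrightarrow> spectral_family E \<and> is_spectral_integral E (\<lambda>\<mu>. \<mu>) S T"


section \<open>Integrals along rectifiable curves\<close>

definition rectifiable_path :: "(real \<Rightarrow> complex) \<Rightarrow> bool"
  where "rectifiable_path g \<longleftrightarrow> path g \<and>
    (\<exists>L. \<forall>n t. mono t \<and> range t \<subseteq> {0..1::real} \<longrightarrow>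
       (\<Sum>i<n. dist (g (t i)) (g (t (Suc i)))) \<le> L)"

text \<open>The integral \<open>\<integral> d\<mu> f(\<mu>)\<close> along \<open>g\<close>, as a Stieltjes integral \<open>\<integral> f(g(t)) dg(t)\<close> of gauge type:
  the definition of \<^const>\<open>has_integral\<close> on \<open>{0..1}\<close> with increments of \<open>g\<close> in place of lengths.
  The values of \<open>f\<close> at the two end points of the curve do not matter.\<close>

definition has_path_integral ::
  "(complex \<Rightarrow> 'b::complex_normed_vector) \<Rightarrow> 'b \<Rightarrow> (real \<Rightarrow> complex) \<Rightarrow> bool"
  where "has_path_integral f I g \<longleftrightarrow>
    (\<forall>e>0. \<exists>\<gamma>. gauge \<gamma> \<and>
      (\<forall>p. p tagged_division_of {0..1::real} \<and> \<gamma> fine p \<longrightarrow>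
        norm ((\<Sum>(t, k)\<in>p. (g (Sup k) - g (Inf k)) *\<^sub>C f (g t)) - I) < e))"

definition path_integral :: "(real \<Rightarrow> complex) \<Rightarrow> (complex \<Rightarrow> 'b::complex_normed_vector) \<Rightarrow> 'b"
  where "path_integral g f = (THE I. has_path_integral f I g)"


section \<open>Contours and transfer functions\<close>

text \<open>The closed neighbourhood \<open>O\<^sub>\<eta>([a,b])\<close> of a real segment.\<close>

definition segment_nbhd :: "real \<Rightarrow> real \<Rightarrow> real \<Rightarrow> complex set"
  where "segment_nbhd \<eta> a b = {z. infdist z (complex_of_real ` {a..b}) \<le> \<eta>}"

definition half_domain :: "complex set \<Rightarrow> int \<Rightarrow> complex set"
  where "half_domain \<D> l = {z \<in> \<D>. of_int l * Im z > 0}"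

text \<open>\<open>g\<close> parametrizes the bounded part of a contour. The deformation of the interval keeps the
  end points fixed; every intermediate curve stays, apart from its end points (which need not
  belong to \<open>\<D>\<close>), in \<open>\<D>\<close>.\<close>

definition deformed_interval ::
  "complex set \<Rightarrow> int \<Rightarrow> real \<Rightarrow> real \<Rightarrow> (real \<Rightarrow> complex) \<Rightarrow> bool"
  where "deformed_interval \<D> l a b g \<longleftrightarrow>
    arc g \<and> rectifiable_path g \<and>
    pathstart g = complex_of_real a \<and> pathfinish g = complex_of_real b \<and>
    g ` {0<..<1} \<subseteq> half_domain \<D> l \<and>
    homotopic_with_canon
      (\<lambda>p. pathstart p = complex_of_real a \<and> pathfinish p = complex_of_real b \<and> p ` {0<..<1} \<subseteq> \<D>)
      {0..1} UNIV (linepath (complex_of_real a) (complex_of_real b)) g"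

text \<open>The set \<open>\<Gamma>\<close>.\<close>

definition contour :: "(real \<Rightarrow> complex) \<Rightarrow> real \<Rightarrow> complex set"
  where "contour g \<beta> = path_image g \<union> complex_of_real ` {\<beta>..}"

text \<open>Below, \<open>dK\<close> is the derivative of the analytic continuation of \<open>K\<close> and is used on the curve
  \<open>g\<close>; \<open>dKr\<close> is the derivative of \<open>K\<close> on the real axis and is used on \<open>[\<beta>,+\<infinity>)\<close>. They must be kept
  apart, since the continuation is only tied to \<open>K\<close> on the interval to the left of \<open>\<beta>\<close>.\<close>

definition contour_integral_op ::
  "(real \<Rightarrow> complex) \<Rightarrow> real \<Rightarrow>
   (complex \<Rightarrow> 'a::complex_normed_vector \<Rightarrow>\<^sub>B 'a) \<Rightarrow> (real \<Rightarrow> 'a \<Rightarrow>\<^sub>B 'a) \<Rightarrow>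
   (complex \<Rightarrow> ('a \<Rightarrow>\<^sub>B 'a) \<Rightarrow> ('a \<Rightarrow>\<^sub>B 'a)) \<Rightarrow> ('a \<Rightarrow>\<^sub>B 'a)"
  where "contour_integral_op g \<beta> dK dKr F =
    path_integral g (\<lambda>\<mu>. F \<mu> (dK \<mu>)) +
    integral {\<beta>..} (\<lambda>\<mu>. F (complex_of_real \<mu>) (dKr \<mu>))"

definition transfer_V ::
  "(real \<Rightarrow> complex) \<Rightarrow> real \<Rightarrow>
   (complex \<Rightarrow> 'a::complex_normed_vector \<Rightarrow>\<^sub>B 'a) \<Rightarrow> (real \<Rightarrow> 'a \<Rightarrow>\<^sub>B 'a) \<Rightarrow>
   complex \<Rightarrow> ('a \<Rightarrow>\<^sub>B 'a)"
  where "transfer_V g \<beta> dK dKr z =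
    contour_integral_op g \<beta> dK dKr (\<lambda>\<mu> T. (z / (z - \<mu>)) *\<^sub>C T)"

definition transfer_M ::
  "('a::complex_normed_vector \<Rightarrow>\<^sub>B 'a) \<Rightarrow> (real \<Rightarrow> complex) \<Rightarrow> real \<Rightarrow>
   (complex \<Rightarrow> 'a \<Rightarrow>\<^sub>B 'a) \<Rightarrow> (real \<Rightarrow> 'a \<Rightarrow>\<^sub>B 'a) \<Rightarrow> complex \<Rightarrow> ('a \<Rightarrow>\<^sub>B 'a)"
  where "transfer_M At g \<beta> dK dKr z = At - z *\<^sub>C bop_id + transfer_V g \<beta> dK dKr z"

definition transfer_V_right ::
  "(real \<Rightarrow> complex) \<Rightarrow> real \<Rightarrow>
   (complex \<Rightarrow> 'a::complex_normed_vector \<Rightarrow>\<^sub>B 'a) \<Rightarrow> (real \<Rightarrow> 'a \<Rightarrow>\<^sub>B 'a) \<Rightarrow>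
   ('a \<Rightarrow>\<^sub>B 'a) \<Rightarrow> ('a \<Rightarrow>\<^sub>B 'a)"
  where "transfer_V_right g \<beta> dK dKr Z =
    contour_integral_op g \<beta> dK dKr (\<lambda>\<mu> T. T o\<^sub>B Z o\<^sub>B bop_inverse (Z - \<mu> *\<^sub>C bop_id))"

text \<open>\<open>z\<close> is an eigenvalue, with eigenvector \<open>u\<close>, of an operator function defined off \<open>\<Gamma>\<close>.\<close>

definition function_eigenpair ::
  "complex set \<Rightarrow> (complex \<Rightarrow> 'a::complex_normed_vector \<Rightarrow>\<^sub>B 'a) \<Rightarrow> complex \<Rightarrow> 'a \<Rightarrow> bool"
  where "function_eigenpair \<Gamma> M z u \<longleftrightarrow> z \<notin> \<Gamma> \<and> u \<noteq> 0 \<and> bop_apply (M z) u = 0"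

end

theory Submission
  imports Defs "HOL-Complex_Analysis.Complex_Analysis"
begin

text \<open>Since \<open>(Z - \<mu>)\<^sup>-\<^sup>1 u = (z - \<mu>)\<^sup>-\<^sup>1 u\<close>, the integrands of \<open>V\<^sup>\<triangleright>(Z)\<close> and \<open>V(z)\<close> agree at \<open>u\<close> for every
  \<open>\<mu>\<close> on the contour, so the point is that both integrals converge in operator norm. On the curve,
  the bounds at \<open>\<lambda>\<^sub>C\<close> and \<open>\<beta>\<close> both hold on all of \<open>\<D>\<close>, and every point is far from one of the two, so
  \<open>K'\<close> is bounded; by Cauchy's estimate it is then continuous, and a bounded function that is
  continuous along the interior of a rectifiable curve is Stieltjes integrable. On the half-line,
  the multipliers \<open>Z (Z - \<mu>)\<^sup>-\<^sup>1\<close> and \<open>z / (z - \<mu>)\<close> are \<open>O((1 + |\<mu>|)\<^sup>-\<^sup>1)\<close>.\<close>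

section \<open>Bounded operators\<close>

text \<open>Convergence matters because evaluation at \<open>u\<close> has to be moved inside the
  integrals: a divergent \<open>path_integral\<close> is an unspecified operator and a divergent
  \<open>integral\<close> is 0, so agreement of the integrands at \<open>u\<close> alone says
  nothing about the two operators. Two obstacles shape the estimates. The end points of the curve
  need not lie in \<open>\<D>\<close>, so \<open>dK\<close> may take arbitrary values there and the
  integrand may jump; tags at 0 and 1 are therefore controlled by the small variation of
  \<open>g\<close> near the ends instead of by continuity. And the integrals take values in a
  general Banach space, so on the curve as well as on the half-line existence is derived from a
  Cauchy criterion for gauge integrals.\<close>

lemma bounded_bilinear_scaleC:
  "bounded_bilinear (scaleC :: complex \<Rightarrow> 'a::complex_normed_vector \<Rightarrow> 'a)"
proof
  fix r :: real and c d :: complex and x y :: 'a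
  show "(c + d) *\<^sub>C x = c *\<^sub>C x + d *\<^sub>C x" by (rule scaleC_add_left)
  show "c *\<^sub>C (x + y) = c *\<^sub>C x + c *\<^sub>C y" by (rule scaleC_add_right)
  show "(r *\<^sub>R c) *\<^sub>C x = r *\<^sub>R (c *\<^sub>C x)"
    by (simp add: scaleR_conv_of_real flip: scaleC_of_real scaleC_scaleC)
  show "c *\<^sub>C (r *\<^sub>R x) = r *\<^sub>R (c *\<^sub>C x)" by (rule scaleC_scaleR_right)
  show "\<exists>K. \<forall>c (x::'a). norm (c *\<^sub>C x) \<le> norm c * norm x * K"
    by (intro exI[of _ 1]) (simp add: norm_scaleC)
qed

lemmas scaleC_diff_left = bounded_bilinear.diff_left[OF bounded_bilinear_scaleC]
lemmas scaleC_sum_left = bounded_bilinear.sum_left[OF bounded_bilinear_scaleC]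

lemma bounded_bilinear_bop_apply:
  "bounded_bilinear (bop_apply :: ('a::complex_normed_vector \<Rightarrow>\<^sub>B 'b::complex_normed_vector) \<Rightarrow> _)"
proof
  fix r :: real and S T :: "'a \<Rightarrow>\<^sub>B 'b" and x y :: 'a
  show "bop_apply (S + T) x = bop_apply S x + bop_apply T x"
    by transfer (rule blinfun.add_left)
  show "bop_apply T (x + y) = bop_apply T x + bop_apply T y"
    by transfer (rule blinfun.add_right)
  show "bop_apply (r *\<^sub>R T) x = r *\<^sub>R bop_apply T x"
    by transfer (rule blinfun.scaleR_left)
  show "bop_apply T (r *\<^sub>R x) = r *\<^sub>R bop_apply T x"
    by transfer (rule blinfun.scaleR_right)
  show "\<exists>K. \<forall>(T::'a \<Rightarrow>\<^sub>B 'b) x. norm (bop_apply T x) \<le> norm T * norm x * K"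
    by (intro exI[of _ 1], transfer) (simp add: norm_blinfun)
qed

interpretation bop: bounded_bilinear
  "bop_apply :: ('a::complex_normed_vector \<Rightarrow>\<^sub>B 'b::complex_normed_vector) \<Rightarrow> _"
  by (rule bounded_bilinear_bop_apply)

lemma norm_bop_apply: "norm (bop_apply T x) \<le> norm T * norm x"
  by transfer (rule norm_blinfun)

lemma norm_bop_bound:
  assumes "0 \<le> b" "\<And>x. norm (bop_apply T x) \<le> b * norm x"
  shows "norm T \<le> b"
  using assms by transfer (rule norm_blinfun_bound)

lemma bop_eqI: "(\<And>x. bop_apply S x = bop_apply T x) \<Longrightarrow> S = T"
  by transfer (rule blinfun_eqI)

lemma bop_apply_scaleC_right: "bop_apply T (c *\<^sub>C x) = c *\<^sub>C bop_apply T x"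
  by transfer simp

lemma bop_apply_scaleC_left: "bop_apply (c *\<^sub>C T) x = c *\<^sub>C bop_apply T x"
  by transfer (rule blinfun_scaleC_apply)

lemma bop_apply_id [simp]: "bop_apply bop_id x = x"
  by transfer simp

lemma bop_apply_compose [simp]: "bop_apply (S o\<^sub>B T) x = bop_apply S (bop_apply T x)"
  by transfer simp

lemma norm_bop_compose: "norm (S o\<^sub>B T) \<le> norm S * norm T"
  by transfer (rule norm_blinfun_compose)

lemma bounded_bilinear_bop_compose:
  "bounded_bilinear (bop_compose :: ('b::complex_normed_vector \<Rightarrow>\<^sub>B 'c::complex_normed_vector) \<Rightarrow>
     ('a::complex_normed_vector \<Rightarrow>\<^sub>B 'b) \<Rightarrow> _)"
proof
  fix r :: real and S S' :: "'b \<Rightarrow>\<^sub>B 'c" and T T' :: "'a \<Rightarrow>\<^sub>B 'b"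
  show "(S + S') o\<^sub>B T = S o\<^sub>B T + S' o\<^sub>B T" "S o\<^sub>B (T + T') = S o\<^sub>B T + S o\<^sub>B T'"
    "(r *\<^sub>R S) o\<^sub>B T = r *\<^sub>R (S o\<^sub>B T)" "S o\<^sub>B (r *\<^sub>R T) = r *\<^sub>R (S o\<^sub>B T)"
    by (rule bop_eqI, simp add: bop.add_left bop.add_right bop.scaleR_left bop.scaleR_right)+
  show "\<exists>K. \<forall>(S::'b \<Rightarrow>\<^sub>B 'c) (T::'a \<Rightarrow>\<^sub>B 'b). norm (S o\<^sub>B T) \<le> norm S * norm T * K"
    by (intro exI[of _ 1]) (simp add: norm_bop_compose)
qed


section \<open>Stieltjes integrals along rectifiable paths\<close>

text \<open>The integrand is a function of the parameter rather than of the point on the curve, so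
  that continuity can be required on \<open>{0<..<1}\<close> and mere boundedness at the end
  points.\<close>

definition stieltjes_sum ::
  "(real \<Rightarrow> complex) \<Rightarrow> (real \<Rightarrow> 'b::complex_normed_vector) \<Rightarrow> (real \<times> real set) set \<Rightarrow> 'b"
  where "stieltjes_sum g \<phi> p = (\<Sum>(t, k)\<in>p. (g (Sup k) - g (Inf k)) *\<^sub>C \<phi> t)"

lemma has_path_integral_iff:
  "has_path_integral f I g \<longleftrightarrow>
    (\<forall>e>0. \<exists>\<gamma>. gauge \<gamma> \<and> (\<forall>p. p tagged_division_of {0..1} \<and> \<gamma> fine p \<longrightarrow>
       norm (stieltjes_sum g (\<lambda>t. f (g t)) p - I) < e))"
  unfolding has_path_integral_def stieltjes_sum_def ..

text \<open>Both sides are the increment of \<open>f\<close> over the intersection of [u,v] and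
  [a,b], and both vanish if the two intervals are disjoint.\<close>

lemma clamp_increment_swap:
  fixes f :: "real \<Rightarrow> 'b::ab_group_add"
  assumes "u \<le> v" "a \<le> b"
  shows "f (max u (min v b)) - f (max u (min v a)) = f (max a (min b v)) - f (max a (min b u))"
proof -
  consider "b < u" | "v < a" | "u \<le> b" "a \<le> v" by linarith
  then show ?thesis
    using assms by cases (simp_all add: min.commute max.commute min.absorb1 min.absorb2
        max.absorb1 max.absorb2 max_min_distrib2)
qed

text \<open>Both sums are expanded over the pairs of intervals of the two divisions. The increment
  of \<open>g\<close> over the intersection of \<open>[u,v]\<close> and \<open>[a,b]\<close> is written as an increment over \<open>[a,b]\<close> of \<open>g\<close>
  composed with the retraction onto \<open>[u,v]\<close>, so that empty intersections need no special case.\<close>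

lemma stieltjes_sum_diff_le:
  fixes g :: "real \<Rightarrow> complex" and \<phi> :: "real \<Rightarrow> 'b::complex_normed_vector" and U :: "real \<Rightarrow> real"
  assumes p: "p tagged_division_of {0..1}" and q: "q tagged_division_of {0..1}"
    and le: "\<And>x y u v a b. (x, {u..v}) \<in> p \<Longrightarrow> (y, {a..b}) \<in> q \<Longrightarrow> u \<le> v \<Longrightarrow> a \<le> b \<Longrightarrow>
      norm ((g (max u (min v b)) - g (max u (min v a))) *\<^sub>C (\<phi> x - \<phi> y)) \<le>
      U (max u (min v b)) - U (max u (min v a))"
  shows "norm (stieltjes_sum g \<phi> p - stieltjes_sum g \<phi> q) \<le> U 1 - U 0"
proof -
  have interval: "k = {Inf k..Sup k}" "Inf k \<le> Sup k" "0 \<le> Inf k" "Sup k \<le> 1"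
    if r: "r tagged_division_of {0..1}" and k: "(x, k) \<in> r" for r and x :: real and k
  proof -
    obtain u v where uv: "k = {u..v}" "x \<in> k" "k \<subseteq> {0..1}"
      using tagged_division_ofD(2-4)[OF r k] by (metis box_real(2))
    then have "u \<le> v" by auto
    with uv show "k = {Inf k..Sup k}" "Inf k \<le> Sup k" "0 \<le> Inf k" "Sup k \<le> 1"
      by simp_all
  qed
  define c where "c k x = max (Inf k) (min (Sup k) x)" for k and x :: real
  define I where "I f k l = f (c k (Sup l)) - f (c k (Inf l))"
    for f :: "real \<Rightarrow> complex" and k l :: "real set"
  define J where "J k l = U (c k (Sup l)) - U (c k (Inf l))" for k l :: "real set"
  \<comment> \<open>Telescoping over \<open>r\<close> of \<open>f\<close> composed with the
    retraction \<open>c k\<close>, which sends 0 and 1 to the end points of \<open>k\<close>. The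
    value type is left open because both \<open>g\<close> and the majorant \<open>U\<close> are
    expanded this way.\<close>
  have sum1: "(\<Sum>(y, l)\<in>r. f (c k (Sup l)) - f (c k (Inf l))) = f (Sup k) - f (Inf k)"
    if r: "r tagged_division_of {0..1}" and s: "s tagged_division_of {0..1}" and k: "(x, k) \<in> s"
    for f :: "real \<Rightarrow> 'z::real_normed_vector" and r s k x
  proof -
    have "c k 1 = Sup k" "c k 0 = Inf k"
      using interval(2-4)[OF s k] by (simp_all add: c_def)
    then show ?thesis
      using additive_tagged_division_1[OF _ r, of "\<lambda>t. f (c k t)"] by simp
  qed
  \<comment> \<open>Expanding the second sum produces the increments \<open>I g l k\<close>. After
    the exchange both double sums carry the same weights, and their difference only involves
    \<open>\<phi> t - \<phi> s\<close>.\<close>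
  have swap: "I g k l = I g l k" if "(x, k) \<in> p" "(y, l) \<in> q" for x y k l
    unfolding I_def c_def
    by (rule clamp_increment_swap[OF interval(2)[OF p that(1)] interval(2)[OF q that(2)]])
  have fin: "finite p" "finite q" using p q by auto
  have P: "(\<Sum>(t, k)\<in>p. (g (Sup k) - g (Inf k)) *\<^sub>C \<phi> t) =
      (\<Sum>(t, k)\<in>p. \<Sum>(s, l)\<in>q. I g k l *\<^sub>C \<phi> t)"
    using sum1[OF q p, of _ _ g]
    by (intro sum.cong refl) (auto simp: I_def split_def simp flip: scaleC_sum_left)
  have Q: "(\<Sum>(s, l)\<in>q. (g (Sup l) - g (Inf l)) *\<^sub>C \<phi> s) =
      (\<Sum>(s, l)\<in>q. \<Sum>(t, k)\<in>p. I g l k *\<^sub>C \<phi> s)"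
    using sum1[OF p q, of _ _ g]
    by (intro sum.cong refl) (auto simp: I_def split_def simp flip: scaleC_sum_left)
  also have "\<dots> = (\<Sum>(t, k)\<in>p. \<Sum>(s, l)\<in>q. I g l k *\<^sub>C \<phi> s)"
    by (simp only: split_def, rule sum.swap)
  also have "\<dots> = (\<Sum>(t, k)\<in>p. \<Sum>(s, l)\<in>q. I g k l *\<^sub>C \<phi> s)"
    by (intro sum.cong refl, clarsimp, intro sum.cong refl, clarsimp, metis swap)
  finally have Q': "(\<Sum>(s, l)\<in>q. (g (Sup l) - g (Inf l)) *\<^sub>C \<phi> s) =
      (\<Sum>(t, k)\<in>p. \<Sum>(s, l)\<in>q. I g k l *\<^sub>C \<phi> s)" .
  have "norm (stieltjes_sum g \<phi> p - stieltjes_sum g \<phi> q) =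
      norm (\<Sum>(t, k)\<in>p. \<Sum>(s, l)\<in>q. I g k l *\<^sub>C (\<phi> t - \<phi> s))"
    unfolding stieltjes_sum_def P Q' by (simp add: split_def scaleC_diff_right sum_subtractf)
  also have "\<dots> \<le> (\<Sum>(t, k)\<in>p. \<Sum>(s, l)\<in>q. J k l)"
  proof -
    have "norm (I g k l *\<^sub>C (\<phi> t - \<phi> s)) \<le> J k l" if "(t, k) \<in> p" "(s, l) \<in> q" for t k s l
    proof -
      have "(t, {Inf k..Sup k}) \<in> p" "(s, {Inf l..Sup l}) \<in> q"
        using that interval(1)[OF p that(1)] interval(1)[OF q that(2)] by simp_all
      then show ?thesis
        unfolding I_def J_def c_def
        by (rule le[OF _ _ interval(2)[OF p that(1)] interval(2)[OF q that(2)]])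
    qed
    then show ?thesis
      by (intro sum_norm_le) (auto intro!: sum_norm_le)
  qed
  also have "\<dots> = (\<Sum>(t, k)\<in>p. U (Sup k) - U (Inf k))"
    using sum1[OF q p, of _ _ U] by (intro sum.cong refl) (auto simp: J_def split_def)
  also have "\<dots> = U 1 - U 0"
    by (rule additive_tagged_division_1[OF _ p]) simp
  finally show ?thesis .
qed

text \<open>\<open>W x\<close> is the total variation of \<open>g\<close> on \<open>{0..x}\<close>.
  Only one half of its additivity is wanted: a polygon inscribed on \<open>{0..u}\<close> can be
  prolonged by the chord from \<open>u\<close> to \<open>v\<close>.\<close>

lemma rectifiable_path_variation:
  assumes g: "rectifiable_path g"
  obtains W :: "real \<Rightarrow> real" where
    "\<And>u v. 0 \<le> u \<Longrightarrow> u \<le> v \<Longrightarrow> v \<le> 1 \<Longrightarrow> cmod (g v - g u) \<le> W v - W u"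
proof -
  obtain L where L: "\<And>n t. mono t \<Longrightarrow> range t \<subseteq> {0..1::real} \<Longrightarrow>
       (\<Sum>i<n. dist (g (t i)) (g (t (Suc i)))) \<le> L"
    using g unfolding rectifiable_path_def by blast
  define S where "S x = {(\<Sum>i<n. dist (g (t i)) (g (t (Suc i)))) | n t. mono t \<and> range t \<subseteq> {0..x}}"
    for x :: real
  have bdd: "bdd_above (S x)" if "x \<le> 1" for x
    using that L by (intro bdd_aboveI[of _ L]) (force simp: S_def)
  have ne: "S x \<noteq> {}" if "0 \<le> x" for x
  proof -
    have "(\<Sum>i<0. dist (g 0) (g 0)) \<in> S x"
      unfolding S_def using that
      by (intro CollectI exI[of _ "0::nat"] exI[of _ "\<lambda>_. 0"]) (auto simp: mono_def)
    then show ?thesis by blast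
  qed
  have "cmod (g v - g u) \<le> Sup (S v) - Sup (S u)" if uv: "0 \<le> u" "u \<le> v" "v \<le> 1" for u v
  proof -
    have "s \<le> Sup (S v) - cmod (g v - g u)" if "s \<in> S u" for s
    proof -
      from that obtain n t where s: "s = (\<Sum>i<n. dist (g (t i)) (g (t (Suc i))))"
        and t: "mono t" "range t \<subseteq> {0..u}"
        unfolding S_def by blast
      \<comment> \<open>The partition \<open>t\<close> up to index \<open>n\<close>, then
        \<open>u\<close>, then \<open>v\<close> forever. The extra segment from \<open>t n\<close>
        to \<open>u\<close> contributes a nonnegative length, and the next one is the chord.\<close>
      define t' where "t' i = (if i \<le> n then t i else if i = Suc n then u else v)" for i
      have t_le: "0 \<le> t i" "t i \<le> u" for i using t(2) by (auto simp: image_subset_iff)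
      have "mono t'"
        unfolding t'_def using t_le uv monoD[OF t(1)] order_trans[OF t_le(2) uv(2)]
        by (auto intro!: monoI)
      moreover have "range t' \<subseteq> {0..v}"
        unfolding t'_def using t_le uv order_trans[OF t_le(2) uv(2)] by auto
      ultimately have "(\<Sum>i<Suc (Suc n). dist (g (t' i)) (g (t' (Suc i)))) \<in> S v"
        unfolding S_def by blast
      then have "(\<Sum>i<Suc (Suc n). dist (g (t' i)) (g (t' (Suc i)))) \<le> Sup (S v)"
        using bdd uv by (intro cSup_upper) auto
      moreover have "(\<Sum>i<n. dist (g (t' i)) (g (t' (Suc i)))) = s"
        unfolding s by (intro sum.cong) (auto simp: t'_def)
      moreover have "dist (g (t' (Suc n))) (g (t' (Suc (Suc n)))) = cmod (g v - g u)"
        by (simp add: t'_def dist_norm norm_minus_commute)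
      ultimately show ?thesis
        using zero_le_dist[of "g (t' n)" "g (t' (Suc n))"] by (simp only: sum.lessThan_Suc)
    qed
    then have "Sup (S u) \<le> Sup (S v) - cmod (g v - g u)"
      using ne uv by (intro cSup_least) auto
    then show ?thesis by simp
  qed
  then show ?thesis by (rule that)
qed

text \<open>The variation is continuous at the end points; instead of proving this, its values there are
  replaced by its one-sided limits.\<close>

lemma rectifiable_path_variation_continuous_ends:
  assumes g: "rectifiable_path g"
  obtains W :: "real \<Rightarrow> real" where
    "\<And>u v. 0 \<le> u \<Longrightarrow> u \<le> v \<Longrightarrow> v \<le> 1 \<Longrightarrow> cmod (g v - g u) \<le> W v - W u"
    "\<And>e. e > 0 \<Longrightarrow> \<exists>d\<in>{0<..<1}. W d - W 0 < e \<and> W 1 - W (1 - d) < e"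
proof -
  obtain V :: "real \<Rightarrow> real" where
    V: "\<And>u v. 0 \<le> u \<Longrightarrow> u \<le> v \<Longrightarrow> v \<le> 1 \<Longrightarrow> cmod (g v - g u) \<le> V v - V u"
    using rectifiable_path_variation[OF g] by blast
  have mono: "V u \<le> V v" if "0 \<le> u" "u \<le> v" "v \<le> 1" for u v
    using V[OF that] norm_ge_zero[of "g v - g u"] by linarith
  have cont: "continuous_on {0..1} g"
    using g by (simp add: rectifiable_path_def path_def)
  define a where "a = Inf (V ` {0<..<1})"
  define b where "b = Sup (V ` {0<..<1})"
  define W where "W x = (if x = 0 then a else if x = 1 then b else V x)" for x
  have bb: "bdd_below (V ` {0<..<1})" by (intro bdd_belowI[of _ "V 0"]) (auto intro!: mono)
  have ba: "bdd_above (V ` {0<..<1})" by (intro bdd_aboveI[of _ "V 1"]) (auto intro!: mono)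
  have ab: "a \<le> V x" "V x \<le> b" if "0 < x" "x < 1" for x
    using that unfolding a_def b_def by (auto intro!: cInf_lower cSup_upper bb ba)
  have inner: "cmod (g v - g u) \<le> W v - W u" if "0 < u" "u \<le> v" "v < 1" for u v
    using V[of u v] that by (simp add: W_def)
  \<comment> \<open>The limit of \<open>inner\<close> as \<open>u\<close> tends to 0 from the right:
    continuity of \<open>g\<close> handles one side, and \<open>a \<le> V u\<close> the
    other.\<close>
  have left: "cmod (g v - g 0) \<le> W v - W 0" if "0 < v" "v < 1" for v
  proof (rule tendsto_upperbound)
    have "(g \<longlongrightarrow> g 0) (at 0 within {0..1})"
      using cont by (simp add: continuous_on_def)
    then have "(g \<longlongrightarrow> g 0) (at_right 0)"
      using at_within_Icc_at_right[of 0 "1::real"] by simp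
    then show "((\<lambda>u. cmod (g v - g u)) \<longlongrightarrow> cmod (g v - g 0)) (at_right 0)"
      by (intro tendsto_intros)
    show "\<forall>\<^sub>F u in at_right 0. cmod (g v - g u) \<le> W v - W 0"
    proof -
      have "\<forall>\<^sub>F u in at_right 0. u \<in> {0<..<v}"
        using that by (intro eventually_at_right_real)
      then show ?thesis
      proof eventually_elim
        case (elim u)
        then show ?case using inner[of u v] ab[of u] that by (simp add: W_def)
      qed
    qed
  qed simp
  \<comment> \<open>The case \<open>u = 0\<close> is reached through \<open>left\<close>, so the
    chord over the whole interval is covered too.\<close>
  have right: "cmod (g 1 - g u) \<le> W 1 - W u" if "0 \<le> u" "u < 1" for u
  proof (rule tendsto_upperbound)
    have "(g \<longlongrightarrow> g 1) (at 1 within {0..1})"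
      using cont by (simp add: continuous_on_def)
    then have "(g \<longlongrightarrow> g 1) (at_left 1)"
      using at_within_Icc_at_left[of 0 "1::real"] by simp
    then show "((\<lambda>v. cmod (g v - g u)) \<longlongrightarrow> cmod (g 1 - g u)) (at_left 1)"
      by (intro tendsto_intros)
    show "\<forall>\<^sub>F v in at_left 1. cmod (g v - g u) \<le> W 1 - W u"
    proof -
      have "\<forall>\<^sub>F v in at_left 1. v \<in> {u<..<1}"
        using that by (intro eventually_at_left_real)
      then show ?thesis
      proof eventually_elim
        case (elim v)
        have "cmod (g v - g u) \<le> W v - W u"
          using elim inner[of u v] left[of v] that by (cases "u = 0") auto
        then show ?case using ab[of v] elim that by (simp add: W_def)
      qed
    qed
  qed simp
  show ?thesis
  proof (rule that)
    fix u v :: real assume uv: "0 \<le> u" "u \<le> v" "v \<le> 1"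
    then consider "u = v" | "v = 1" "u < 1" | "u = 0" "0 < v" "v < 1" | "0 < u" "v < 1"
      by linarith
    then show "cmod (g v - g u) \<le> W v - W u"
      using uv inner left right by cases auto
  next
    fix e :: real assume "e > 0"
    obtain x where x: "0 < x" "x < 1" "V x < a + e"
      using cInf_lessD[of "V ` {0<..<1}" "a + e"] \<open>e > 0\<close> unfolding a_def by auto
    obtain y where y: "0 < y" "y < 1" "b - e < V y"
      using less_cSupD[of "V ` {0<..<1}" "b - e"] \<open>e > 0\<close> unfolding b_def by auto
    define d where "d = min x (1 - y)"
    have "V d \<le> V x" "V y \<le> V (1 - d)" "0 < d" "d < 1"
      using x y by (auto simp: d_def intro!: mono)
    then show "\<exists>d\<in>{0<..<1}. W d - W 0 < e \<and> W 1 - W (1 - d) < e"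
      using x y by (intro bexI[of _ d]) (auto simp: W_def)
  qed
qed

text \<open>Two kinds of overlapping cells occur. If both tags are interior, \<open>\<phi>\<close>
  oscillates little and the variation of \<open>g\<close> is bounded; if a tag is an end point,
  \<open>\<phi>\<close> is merely bounded, but the cell lies where the variation of \<open>g\<close>
  is small.\<close>

lemma stieltjes_Cauchy:
  fixes \<phi> :: "real \<Rightarrow> 'b::complex_normed_vector"
  assumes g: "rectifiable_path g"
    and cont: "continuous_on {0<..<1} \<phi>"
    and bound: "\<And>t. t \<in> {0..1} \<Longrightarrow> norm (\<phi> t) \<le> M"
    and e: "e > 0"
  obtains \<gamma> where "gauge \<gamma>"
    "\<And>p q. p tagged_division_of {0..1} \<Longrightarrow> \<gamma> fine p \<Longrightarrow> q tagged_division_of {0..1} \<Longrightarrow> \<gamma> fine q \<Longrightarrow>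
      norm (stieltjes_sum g \<phi> p -
            stieltjes_sum g \<phi> q) < e"
proof -
  obtain W :: "real \<Rightarrow> real" where
    W: "\<And>u v. 0 \<le> u \<Longrightarrow> u \<le> v \<Longrightarrow> v \<le> 1 \<Longrightarrow> cmod (g v - g u) \<le> W v - W u" and
    W_ends: "\<And>e. e > 0 \<Longrightarrow> \<exists>d\<in>{0<..<1}. W d - W 0 < e \<and> W 1 - W (1 - d) < e"
    using rectifiable_path_variation_continuous_ends[OF g] by blast
  have W_mono: "W u \<le> W v" if "0 \<le> u" "u \<le> v" "v \<le> 1" for u v
    using W[OF that] norm_ge_zero[of "g v - g u"] by linarith
  have M: "M \<ge> 0"
    using bound[of 0] norm_ge_zero[of "\<phi> 0"] by (simp del: norm_ge_zero)
  \<comment> \<open>Chosen so that the total growth of the majorant \<open>U\<close> is at most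
    \<open>\<epsilon> * N - \<epsilon>\<close>; the summand 1 keeps \<open>N\<close> positive and
    the final inequality strict.\<close>
  define N where "N = 2 * (W 1 - W 0) + 4 * M + 1"
  have N: "N > 0" using W_mono[of 0 1] M by (simp add: N_def)
  define \<epsilon> where "\<epsilon> = e / N"
  have \<epsilon>: "\<epsilon> > 0" using e N by (simp add: \<epsilon>_def)
  obtain d where d: "0 < d" "d < 1" "W d - W 0 < \<epsilon>" "W 1 - W (1 - d) < \<epsilon>"
    using W_ends[OF \<epsilon>] by auto
  have "\<forall>t\<in>{0<..<1}. \<exists>r>0. \<forall>s\<in>{0<..<1}. dist s t < r \<longrightarrow> dist (\<phi> s) (\<phi> t) < \<epsilon>"
    using cont \<epsilon> unfolding continuous_on_iff by blast
  then obtain r where r: "\<And>t. t \<in> {0<..<1} \<Longrightarrow> r t > 0"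
    "\<And>t s. t \<in> {0<..<1} \<Longrightarrow> s \<in> {0<..<1} \<Longrightarrow> dist s t < r t \<Longrightarrow> dist (\<phi> s) (\<phi> t) < \<epsilon>"
    by metis
  define \<rho> where "\<rho> t = (if t \<in> {0<..<1} then min (r t) (min t (1 - t)) else d)" for t
  \<comment> \<open>The first term pays for interior tags. The other two grow only on
    \<open>{0..d}\<close> and on \<open>{1 - d..1}\<close>, and pay for tags at 0 and 1.\<close>
  define U where "U x = 2 * \<epsilon> * W x + 2 * M * (W (min d x) + W (max (1 - d) x))" for x
  have U_total: "U 1 - U 0 < e"
  proof -
    have "U 1 - U 0 = 2 * \<epsilon> * (W 1 - W 0) + 2 * M * ((W d - W 0) + (W 1 - W (1 - d)))"
      using d by (simp add: U_def algebra_simps)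
    also have "\<dots> \<le> 2 * \<epsilon> * (W 1 - W 0) + 2 * M * (\<epsilon> + \<epsilon>)"
      using d M by (intro add_left_mono mult_left_mono add_mono) auto
    also have "\<dots> = \<epsilon> * N - \<epsilon>" by (simp add: N_def algebra_simps)
    also have "\<dots> < e" using \<epsilon> N by (simp add: \<epsilon>_def)
    finally show ?thesis .
  qed
  have term_le: "norm ((g (max u (min v b)) - g (max u (min v a))) *\<^sub>C (\<phi> x - \<phi> y)) \<le>
      U (max u (min v b)) - U (max u (min v a))"
    if x: "x \<in> {u..v}" "{u..v} \<subseteq> ball x (\<rho> x)" "{u..v} \<subseteq> {0..1}"
      and y: "y \<in> {a..b}" "{a..b} \<subseteq> ball y (\<rho> y)" "{a..b} \<subseteq> {0..1}"
      and "u \<le> v" "a \<le> b" for x y u v a b :: real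
  proof (cases "max u a < min v b")
    case False
    then have "max u (min v b) = max u (min v a)"
      using \<open>u \<le> v\<close> \<open>a \<le> b\<close> by (auto simp: max_def min_def split: if_splits)
    then show ?thesis by (simp add: norm_scaleC)
  next
    case True
    define s where "s = max u a"
    define s' where "s' = min v b"
    have ss: "max u (min v a) = s" "max u (min v b) = s'" "s < s'"
      using True by (auto simp: s_def s'_def max_def min_def split: if_splits)
    have mem: "u \<le> s" "s' \<le> v" "a \<le> s" "s' \<le> b" unfolding s_def s'_def by linarith+
    have "0 \<le> u" "v \<le> 1" using x(3) \<open>u \<le> v\<close> by simp_all
    then have s01: "0 \<le> s" "s' \<le> 1" using mem by linarith+
    have Ws: "W s \<le> W s'" using s01 ss(3) by (intro W_mono) linarith+
    have W1: "W (min d s) \<le> W (min d s')" "W (max (1 - d) s) \<le> W (max (1 - d) s')"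
      using s01 ss(3) d by (intro W_mono; linarith)+
    have gW: "cmod (g s' - g s) \<le> W s' - W s" using s01 ss(3) by (intro W) linarith+
    have \<phi>M: "norm (\<phi> x - \<phi> y) \<le> 2 * M"
      using norm_triangle_ineq4[of "\<phi> x" "\<phi> y"] bound[of x] bound[of y]
        subsetD[OF x(3,1)] subsetD[OF y(3,1)] by linarith
    have "cmod (g s' - g s) * norm (\<phi> x - \<phi> y) \<le> U s' - U s"
    proof (cases "x \<in> {0<..<1} \<and> y \<in> {0<..<1}")
      case True
      \<comment> \<open>\<open>s\<close> or \<open>s'\<close> may be 0 or 1, where
        \<open>\<phi>\<close> need not be continuous; the midpoint is an interior point common to
        both cells, through which the two tags are compared.\<close>
      define m where "m = (s + s') / 2"
      have m: "m \<in> {u..v}" "m \<in> {a..b}" "0 < m" "m < 1"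
        using mem ss(3) s01 by (simp_all add: m_def)
      have "dist m x < r x" "dist m y < r y"
        using subsetD[OF x(2) m(1)] subsetD[OF y(2) m(2)] True
        by (simp_all add: \<rho>_def dist_commute)
      then have "dist (\<phi> m) (\<phi> x) < \<epsilon>" "dist (\<phi> m) (\<phi> y) < \<epsilon>"
        using r(2) True m by auto
      then have "norm (\<phi> x - \<phi> y) \<le> 2 * \<epsilon>"
        using dist_triangle3[of "\<phi> x" "\<phi> y" "\<phi> m"] by (simp add: dist_norm)
      then have "cmod (g s' - g s) * norm (\<phi> x - \<phi> y) \<le> (W s' - W s) * (2 * \<epsilon>)"
        using gW Ws by (intro mult_mono) auto
      moreover have "0 \<le> 2 * M * ((W (min d s') - W (min d s)) +
          (W (max (1 - d) s') - W (max (1 - d) s)))"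
        using M W1 by (intro mult_nonneg_nonneg) auto
      ultimately show ?thesis by (simp add: U_def algebra_simps)
    next
      case False
      have "x = 0 \<or> y = 0 \<or> x = 1 \<or> y = 1"
        using False subsetD[OF x(3,1)] subsetD[OF y(3,1)] by auto
      moreover have "s' < d" if "x = 0"
        using subsetD[OF x(2), of v] \<open>u \<le> v\<close> mem(2) that by (simp add: \<rho>_def dist_real_def)
      moreover have "s' < d" if "y = 0"
        using subsetD[OF y(2), of b] \<open>a \<le> b\<close> mem(4) that by (simp add: \<rho>_def dist_real_def)
      moreover have "1 - d < s" if "x = 1"
        using subsetD[OF x(2), of u] \<open>u \<le> v\<close> mem(1) that by (simp add: \<rho>_def dist_real_def)
      moreover have "1 - d < s" if "y = 1"
        using subsetD[OF y(2), of a] \<open>a \<le> b\<close> mem(3) that by (simp add: \<rho>_def dist_real_def)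
      \<comment> \<open>The cell of an end tag stays within distance \<open>d\<close> of that end,
        and so does the overlap. There one of the truncations \<open>min d\<close> and
        \<open>max (1 - d)\<close> is the identity, so one term of \<open>U\<close> sees the full
        increment of \<open>W\<close>.\<close>
      ultimately have "s' < d \<or> 1 - d < s" by blast
      then have "(min d s' = s' \<and> min d s = s) \<or> (max (1 - d) s' = s' \<and> max (1 - d) s = s)"
        using ss(3) by (elim disjE) simp_all
      then have "W s' - W s \<le> (W (min d s') - W (min d s)) +
          (W (max (1 - d) s') - W (max (1 - d) s))"
        using W1 by auto
      then have "2 * M * (W s' - W s) \<le> 2 * M * ((W (min d s') - W (min d s)) +
          (W (max (1 - d) s') - W (max (1 - d) s)))"
        using M by (intro mult_left_mono) auto
      moreover have "cmod (g s' - g s) * norm (\<phi> x - \<phi> y) \<le> (W s' - W s) * (2 * M)"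
        using gW \<phi>M Ws by (intro mult_mono) auto
      moreover have "0 \<le> 2 * \<epsilon> * (W s' - W s)" using \<epsilon> Ws by simp
      ultimately show ?thesis by (simp add: U_def algebra_simps)
    qed
    then show ?thesis by (simp only: ss norm_scaleC)
  qed
  show ?thesis
  proof (rule that)
    have "\<rho> t > 0" for t using r(1) d by (auto simp: \<rho>_def)
    then show gauge: "gauge (\<lambda>t. ball t (\<rho> t))" by (auto simp: gauge_def)
    fix p q
    assume p: "p tagged_division_of {0..1::real}" "(\<lambda>t. ball t (\<rho> t)) fine p"
      and q: "q tagged_division_of {0..1::real}" "(\<lambda>t. ball t (\<rho> t)) fine q"
    have "norm (stieltjes_sum g \<phi> p -
            stieltjes_sum g \<phi> q) \<le> U 1 - U 0"
    proof (rule stieltjes_sum_diff_le[OF p(1) q(1)])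
      fix x y u v a b :: real
      assume x: "(x, {u..v}) \<in> p" and y: "(y, {a..b}) \<in> q" and "u \<le> v" "a \<le> b"
      show "norm ((g (max u (min v b)) - g (max u (min v a))) *\<^sub>C (\<phi> x - \<phi> y)) \<le>
          U (max u (min v b)) - U (max u (min v a))"
        by (rule term_le[OF tagged_division_ofD(2)[OF p(1) x] fineD[OF p(2) x]
              tagged_division_ofD(3)[OF p(1) x] tagged_division_ofD(2)[OF q(1) y]
              fineD[OF q(2) y] tagged_division_ofD(3)[OF q(1) y]]) fact+
    qed
    then show "norm (stieltjes_sum g \<phi> p -
            stieltjes_sum g \<phi> q) < e"
      using U_total by linarith
  qed
qed

text \<open>Completeness: the sums along divisions that are fine for more and more gauges form a
  Cauchy sequence, and its limit attracts every sufficiently fine sum.\<close>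

lemma has_path_integral_exists:
  fixes f :: "complex \<Rightarrow> 'b::complex_banach"
  assumes g: "rectifiable_path g"
    and cont: "continuous_on {0<..<1} (\<lambda>t. f (g t))"
    and bound: "\<And>t. t \<in> {0..1} \<Longrightarrow> norm (f (g t)) \<le> M"
  shows "\<exists>I. has_path_integral f I g"
proof -
  let ?S = "stieltjes_sum g (\<lambda>t. f (g t))"
  have "\<exists>\<gamma>. gauge \<gamma> \<and> (\<forall>p q. p tagged_division_of {0..1} \<and> \<gamma> fine p \<and>
      q tagged_division_of {0..1} \<and> \<gamma> fine q \<longrightarrow> norm (?S p - ?S q) < 1 / real (Suc n))" for n
    by (rule stieltjes_Cauchy[OF g cont, where M = M and e = "1 / real (Suc n)"])
      (fact bound, simp, metis)
  then obtain G where G: "\<And>n. gauge (G n)"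
    "\<And>n p q. p tagged_division_of {0..1} \<Longrightarrow> G n fine p \<Longrightarrow>
      q tagged_division_of {0..1} \<Longrightarrow> G n fine q \<Longrightarrow> norm (?S p - ?S q) < 1 / real (Suc n)"
    by metis
  \<comment> \<open>Intersecting the first \<open>n + 1\<close> gauges makes \<open>P m\<close>
    comparable with \<open>P n\<close> under the gauge \<open>G n\<close> whenever
    \<open>n \<le> m\<close>.\<close>
  have "\<exists>p. p tagged_division_of {0..1} \<and> (\<forall>i\<le>n. G i fine p)" for n
  proof -
    have "gauge (\<lambda>x. \<Inter>{G i x | i. i \<in> {..n}})"
      by (rule gauge_Inter) (auto simp: G(1))
    then obtain p where "p tagged_division_of {0..1}" "(\<lambda>x. \<Inter>{G i x | i. i \<in> {..n}}) fine p"
      by (rule fine_division_exists_real)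
    then show ?thesis unfolding fine_Inter by (metis atMost_iff)
  qed
  then obtain P where P: "\<And>n. P n tagged_division_of {0..1}" "\<And>i n. i \<le> n \<Longrightarrow> G i fine P n"
    by metis
  have diff: "norm (?S (P m) - ?S (P n)) < 1 / real (Suc n)" if "n \<le> m" for n m
    using that by (intro G(2) P) auto
  have "Cauchy (\<lambda>n. ?S (P n))"
  proof (rule metric_CauchyI)
    fix e :: real assume "e > 0"
    then obtain N where N: "1 / real (Suc N) < e / 2"
      using nat_approx_posE[of "e / 2"] by auto
    have "dist (?S (P m)) (?S (P n)) < e" if "N \<le> m" "N \<le> n" for m n
      using diff[OF that(1)] diff[OF that(2)] N
        dist_triangle2[of "?S (P m)" "?S (P n)" "?S (P N)"] by (simp add: dist_norm)
    then show "\<exists>M. \<forall>m\<ge>M. \<forall>n\<ge>M. dist (?S (P m)) (?S (P n)) < e" by blast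
  qed
  then obtain I where I: "(\<lambda>n. ?S (P n)) \<longlonglongrightarrow> I"
    using Cauchy_convergent convergent_def by blast
  have lim: "norm (I - ?S (P n)) \<le> 1 / real (Suc n)" for n
  proof (rule tendsto_upperbound)
    show "(\<lambda>m. norm (?S (P m) - ?S (P n))) \<longlonglongrightarrow> norm (I - ?S (P n))"
      by (intro tendsto_intros I)
    show "\<forall>\<^sub>F m in sequentially. norm (?S (P m) - ?S (P n)) \<le> 1 / real (Suc n)"
      using diff by (intro eventually_sequentiallyI[of n]) (auto intro: less_imp_le)
  qed simp
  have "\<exists>\<gamma>. gauge \<gamma> \<and> (\<forall>p. p tagged_division_of {0..1} \<and> \<gamma> fine p \<longrightarrow> norm (?S p - I) < e)"
    if "e > 0" for e
  proof -
    obtain N where N: "1 / real (Suc N) < e / 2"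
      using \<open>e > 0\<close> nat_approx_posE[of "e / 2"] by auto
    have "norm (?S p - I) < e" if "p tagged_division_of {0..1}" "G N fine p" for p
      using G(2)[OF that P(1) P(2)[OF order_refl]] lim[of N] N
        norm_triangle_ineq4[of "?S p - ?S (P N)" "I - ?S (P N)"] by simp
    then show ?thesis using G(1) by metis
  qed
  then show ?thesis
    unfolding has_path_integral_iff by metis
qed

text \<open>Some division is fine for both gauges (Cousin's lemma). This gives meaning to
  \<open>path_integral\<close>, which is a definite description.\<close>

lemma has_path_integral_unique:
  assumes "has_path_integral f I g" "has_path_integral f J g"
  shows "I = J"
proof (rule ccontr)
  assume "I \<noteq> J"
  then have e: "norm (I - J) / 2 > 0" by simp
  obtain \<gamma>1 where 1: "gauge \<gamma>1" "\<And>p. p tagged_division_of {0..1} \<Longrightarrow> \<gamma>1 fine p \<Longrightarrow>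
      norm (stieltjes_sum g (\<lambda>t. f (g t)) p - I) < norm (I - J) / 2"
    using assms(1) e unfolding has_path_integral_iff by metis
  obtain \<gamma>2 where 2: "gauge \<gamma>2" "\<And>p. p tagged_division_of {0..1} \<Longrightarrow> \<gamma>2 fine p \<Longrightarrow>
      norm (stieltjes_sum g (\<lambda>t. f (g t)) p - J) < norm (I - J) / 2"
    using assms(2) e unfolding has_path_integral_iff by metis
  obtain p where p: "p tagged_division_of {0..1}" "\<gamma>1 fine p" "\<gamma>2 fine p"
    using fine_division_exists_real[OF gauge_Int[OF 1(1) 2(1)], of 0 1] unfolding fine_Int by metis
  let ?s = "stieltjes_sum g (\<lambda>t. f (g t)) p"
  have "norm (I - J) \<le> norm (?s - J) + norm (?s - I)"
    using norm_triangle_ineq4[of "?s - J" "?s - I"] by simp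
  then show False using 1(2)[OF p(1,2)] 2(2)[OF p(1,3)] by simp
qed

lemma has_path_integral_path_integral:
  "has_path_integral f I g \<Longrightarrow> has_path_integral f (path_integral g f) g"
  unfolding path_integral_def by (rule theI[of "\<lambda>I. has_path_integral f I g"])
    (auto intro: has_path_integral_unique)

lemma has_path_integral_cong:
  assumes "\<And>\<mu>. \<mu> \<in> path_image g \<Longrightarrow> f \<mu> = f' \<mu>" "has_path_integral f I g"
  shows "has_path_integral f' I g"
proof -
  have eq: "stieltjes_sum g (\<lambda>t. f (g t)) p =
      stieltjes_sum g (\<lambda>t. f' (g t)) p"
    if p: "p tagged_division_of {0..1}" for p
  proof -
    have "f (g t) = f' (g t)" if "(t, k) \<in> p" for t k
      using tagged_division_ofD(2,3)[OF p that] by (intro assms(1)) (auto simp: path_image_def)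
    then show ?thesis
      unfolding stieltjes_sum_def by (intro sum.cong refl) auto
  qed
  show ?thesis
    using assms(2) unfolding has_path_integral_iff by (simp add: eq cong: conj_cong)
qed

lemma has_path_integral_bop_apply:
  assumes "has_path_integral f I g"
  shows "has_path_integral (\<lambda>\<mu>. bop_apply (f \<mu>) u) (bop_apply I u) g"
  unfolding has_path_integral_iff
proof (intro allI impI)
  fix e :: real assume "e > 0"
  \<comment> \<open>The added 1 covers \<open>u = 0\<close>, where \<open>e / norm u\<close> would
    be 0.\<close>
  then have "e / (norm u + 1) > 0" by (simp add: add_nonneg_pos)
  then obtain \<gamma> where \<gamma>: "gauge \<gamma>" "\<And>p. p tagged_division_of {0..1} \<Longrightarrow> \<gamma> fine p \<Longrightarrow>
      norm (stieltjes_sum g (\<lambda>t. f (g t)) p - I) < e / (norm u + 1)"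
    using assms unfolding has_path_integral_iff by metis
  have "norm (stieltjes_sum g (\<lambda>t. bop_apply (f (g t)) u) p - bop_apply I u) < e"
    if p: "p tagged_division_of {0..1}" "\<gamma> fine p" for p
  proof -
    let ?T = "stieltjes_sum g (\<lambda>t. f (g t)) p - I"
    have "stieltjes_sum g (\<lambda>t. bop_apply (f (g t)) u) p - bop_apply I u =
        bop_apply ?T u"
      by (simp add: stieltjes_sum_def bop.diff_left bop.sum_left bop_apply_scaleC_left split_def)
    also have "norm \<dots> \<le> norm ?T * norm u" by (rule norm_bop_apply)
    also have "\<dots> \<le> norm ?T * (norm u + 1)" by (intro mult_left_mono) auto
    also have "\<dots> < e"
      using \<gamma>(2)[OF p] by (simp add: pos_less_divide_eq add_nonneg_pos)
    finally show ?thesis .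
  qed
  then show "\<exists>\<gamma>. gauge \<gamma> \<and> (\<forall>p. p tagged_division_of {0..1} \<and> \<gamma> fine p \<longrightarrow>
      norm (stieltjes_sum g (\<lambda>t. bop_apply (f (g t)) u) p - bop_apply I u) < e)"
    using \<gamma>(1) by metis
qed


section \<open>The derivative of a holomorphic operator function\<close>

lemma cinner_add_right: "cinner x (y + z) = cinner x y + cinner x (z :: 'a::complex_hilbert_space)"
  by (metis cinner_add_left cinner_commute complex_cnj_add)

lemma cinner_self: "cinner x x = complex_of_real ((norm (x :: 'a::complex_hilbert_space))\<^sup>2)"
proof (rule complex_eqI)
  have "sqrt (Re (cinner x x)) \<ge> 0"
    using norm_ge_zero[of x] by (simp add: norm_eq_sqrt_cinner)
  then show "Re (cinner x x) = Re (complex_of_real ((norm x)\<^sup>2))"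
    by (simp add: norm_eq_sqrt_cinner)
  show "Im (cinner x x) = Im (complex_of_real ((norm x)\<^sup>2))"
    using cinner_commute[of x x] by (simp add: complex_eq_iff)
qed

text \<open>The class already provides the triangle inequality; squaring it for \<open>x + y\<close>
  bounds the real part of the inner product, and a unimodular factor on \<open>x\<close> reduces the
  modulus to the real part.\<close>

lemma Cauchy_Schwarz_cinner: "cmod (cinner x y) \<le> norm x * norm (y :: 'a::complex_hilbert_space)"
proof -
  have Re_le: "Re (cinner x y) \<le> norm x * norm y" for x y :: 'a
  proof -
    have "complex_of_real ((norm (x + y))\<^sup>2) = cinner (x + y) (x + y)" by (simp add: cinner_self)
    also have "\<dots> = cinner x x + cinner x y + cnj (cinner x y) + cinner y y"
      by (simp add: cinner_add_left cinner_add_right flip: cinner_commute)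
    finally have "Re (complex_of_real ((norm (x + y))\<^sup>2)) =
        Re (cinner x x + cinner x y + cnj (cinner x y) + cinner y y)"
      by simp
    then have "(norm (x + y))\<^sup>2 = (norm x)\<^sup>2 + 2 * Re (cinner x y) + (norm y)\<^sup>2"
      by (simp add: cinner_self)
    moreover have "(norm (x + y))\<^sup>2 \<le> (norm x + norm y)\<^sup>2"
      by (intro power_mono norm_triangle_ineq) simp
    ultimately show ?thesis by (simp add: power2_sum)
  qed
  show ?thesis
  proof (cases "cinner x y = 0")
    case False
    define c where "c = cnj (sgn (cinner x y))"
    have "c * cinner x y = complex_of_real (cmod (cinner x y))"
      unfolding c_def sgn_eq using complex_norm_square[of "cinner x y"] False
      by (simp add: field_simps power2_eq_square)
    then have "cmod (cinner x y) = Re (cinner (c *\<^sub>C x) y)"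
      by (simp add: cinner_scaleC_left)
    also have "\<dots> \<le> norm (c *\<^sub>C x) * norm y" by (rule Re_le)
    also have "norm (c *\<^sub>C x) = norm x"
      using False by (simp add: norm_scaleC c_def norm_sgn)
    finally show ?thesis .
  qed simp
qed

text \<open>Taking \<open>y\<close> to be the image of \<open>x\<close> turns bounds on matrix
  elements back into an operator norm bound.\<close>

lemma norm_bop_le_cinner:
  fixes T :: "'a::complex_normed_vector \<Rightarrow>\<^sub>B 'b::complex_hilbert_space"
  assumes "0 \<le> b" "\<And>x y. cmod (cinner (bop_apply T x) y) \<le> b * norm x * norm y"
  shows "norm T \<le> b"
proof (rule norm_bop_bound[OF assms(1)])
  fix x
  have "norm (bop_apply T x) * norm (bop_apply T x) \<le> b * norm x * norm (bop_apply T x)"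
    using assms(2)[of x "bop_apply T x"] by (simp add: cinner_self norm_power power2_eq_square norm_mult)
  then show "norm (bop_apply T x) \<le> b * norm x"
    using assms(1) by (cases "bop_apply T x = 0") auto
qed

lemma bounded_linear_cinner_bop_apply:
  fixes x :: "'a::complex_normed_vector" and y :: "'b::complex_hilbert_space"
  shows "bounded_linear (\<lambda>T :: 'a \<Rightarrow>\<^sub>B 'b. cinner (bop_apply T x) y)"
proof (rule bounded_linear_intro[where K = "norm x * norm y"])
  fix S T :: "'a \<Rightarrow>\<^sub>B 'b" and r :: real
  show "cinner (bop_apply (S + T) x) y = cinner (bop_apply S x) y + cinner (bop_apply T x) y"
    by (simp add: bop.add_left cinner_add_left)
  show "cinner (bop_apply (r *\<^sub>R T) x) y = r *\<^sub>R cinner (bop_apply T x) y"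
    by (simp add: bop.scaleR_left scaleC_of_real scaleR_conv_of_real flip: cinner_scaleC_left)
  have "cmod (cinner (bop_apply T x) y) \<le> norm (bop_apply T x) * norm y"
    by (rule Cauchy_Schwarz_cinner)
  also have "\<dots> \<le> (norm T * norm x) * norm y"
    by (intro mult_right_mono norm_bop_apply) simp
  finally show "cmod (cinner (bop_apply T x) y) \<le> norm T * (norm x * norm y)"
    by (simp add: mult.assoc)
qed

text \<open>Circles of radius \<open>r / 2\<close> about points of \<open>ball a r\<close> stay
  inside \<open>ball a (2 * r)\<close>, so Cauchy's inequality bounds the derivative by
  \<open>M / (r / 2)\<close>.\<close>

lemma bounded_holomorphic_Lipschitz:
  assumes f: "f holomorphic_on ball a (2 * r)" and r: "r > 0"
    and M: "\<And>w. w \<in> ball a (2 * r) \<Longrightarrow> cmod (f w) \<le> M"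
    and w: "w \<in> ball a r"
  shows "cmod (f w - f a) \<le> 2 * M / r * cmod (w - a)"
proof (rule field_differentiable_bound[where f = f and f' = "deriv f" and S = "ball a r"])
  fix v assume v: "v \<in> ball a r"
  have sub: "cball v (r / 2) \<subseteq> ball a (2 * r)"
  proof
    fix x assume "x \<in> cball v (r / 2)"
    then show "x \<in> ball a (2 * r)"
      using v r dist_triangle[of a x v] by simp
  qed
  show "(f has_field_derivative deriv f v) (at v within ball a r)"
    using holomorphic_derivI[OF f open_ball, of v] v r by auto
  have "cmod ((deriv ^^ 1) f v) \<le> fact 1 * M / (r / 2) ^ 1"
  proof (rule Cauchy_inequality)
    show "f holomorphic_on ball v (r / 2)" using f order_trans[OF ball_subset_cball sub] by (rule holomorphic_on_subset)
    show "continuous_on (cball v (r / 2)) f"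
      using holomorphic_on_imp_continuous_on[OF f] sub by (rule continuous_on_subset)
    show "cmod (f x) \<le> M" if "cmod (v - x) = r / 2" for x
      using that sub by (intro M) (auto simp: dist_norm)
  qed (use r in auto)
  then show "cmod (deriv f v) \<le> 2 * M / r" by (simp add: mult.commute)
qed (use w r in auto)

text \<open>Cauchy's estimate for the matrix elements is uniform over unit vectors, so the derivative is
  even locally Lipschitz in norm.\<close>

lemma continuous_on_bounded_bop_derivative:
  fixes K dK :: "complex \<Rightarrow> 'a::complex_normed_vector \<Rightarrow>\<^sub>B 'b::complex_hilbert_space"
  assumes D: "open \<D>"
    and deriv: "\<And>\<mu>. \<mu> \<in> \<D> \<Longrightarrow> (K has_derivative (\<lambda>h. h *\<^sub>C dK \<mu>)) (at \<mu>)"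
    and M: "\<And>\<mu>. \<mu> \<in> \<D> \<Longrightarrow> norm (dK \<mu>) \<le> M"
  shows "continuous_on \<D> dK"
proof (rule continuous_at_imp_continuous_on, rule ballI)
  fix a assume a: "a \<in> \<D>"
  have M0: "0 \<le> M" using M[OF a] norm_ge_zero[of "dK a"] by linarith
  obtain r' where r': "r' > 0" "ball a r' \<subseteq> \<D>"
    using D a open_contains_ball by blast
  define r where "r = r' / 2"
  have r: "r > 0" "ball a (2 * r) \<subseteq> \<D>" using r' by (auto simp: r_def)
  have est: "norm (dK w - dK a) \<le> 2 * M / r * cmod (w - a)" if w: "w \<in> ball a r" for w
  proof (rule norm_bop_le_cinner)
    show "0 \<le> 2 * M / r * cmod (w - a)" using r M0 by simp
    fix x y
    define \<psi> where "\<psi> \<mu> = cinner (bop_apply (dK \<mu>) x) y" for \<mu>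
    define k where "k \<mu> = cinner (bop_apply (K \<mu>) x) y" for \<mu>
    have "(k has_field_derivative \<psi> \<mu>) (at \<mu>)" if "\<mu> \<in> \<D>" for \<mu>
    proof -
      have "(k has_derivative (\<lambda>h. cinner (bop_apply (h *\<^sub>C dK \<mu>) x) y)) (at \<mu>)"
        unfolding k_def by (rule bounded_linear.has_derivative[OF bounded_linear_cinner_bop_apply deriv[OF that]])
      then show ?thesis
        by (simp add: has_field_derivative_def \<psi>_def bop_apply_scaleC_left cinner_scaleC_left
            mult_commute_abs)
    qed
    then have deriv_k: "k holomorphic_on \<D>" "\<And>\<mu>. \<mu> \<in> \<D> \<Longrightarrow> deriv k \<mu> = \<psi> \<mu>"
      using D by (auto simp: holomorphic_on_open intro: DERIV_imp_deriv)
    \<comment> \<open>\<open>\<psi>\<close> is the derivative of the holomorphic function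
      \<open>k\<close> and hence holomorphic itself; regularity of \<open>dK\<close> originates
      here, as \<open>K\<close> is only assumed to be differentiable.\<close>
    have hol: "\<psi> holomorphic_on \<D>"
      using holomorphic_deriv[OF deriv_k(1) D] deriv_k(2) by (simp cong: holomorphic_cong)
    have bound: "cmod (\<psi> \<mu>) \<le> M * norm x * norm y" if "\<mu> \<in> \<D>" for \<mu>
    proof -
      have "cmod (\<psi> \<mu>) \<le> norm (bop_apply (dK \<mu>) x) * norm y"
        unfolding \<psi>_def by (rule Cauchy_Schwarz_cinner)
      also have "\<dots> \<le> M * norm x * norm y"
        using norm_bop_apply[of "dK \<mu>" x] mult_right_mono[OF M[OF that], of "norm x"]
        by (intro mult_right_mono) auto
      finally show ?thesis .
    qed
    have "cmod (\<psi> w - \<psi> a) \<le> 2 * (M * norm x * norm y) / r * cmod (w - a)"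
      using r hol bound w by (intro bounded_holomorphic_Lipschitz) (auto intro: holomorphic_on_subset)
    then show "cmod (cinner (bop_apply (dK w - dK a) x) y) \<le>
        2 * M / r * cmod (w - a) * norm x * norm y"
      by (simp add: \<psi>_def mult_ac
          linear_diff[OF bounded_linear.linear[OF bounded_linear_cinner_bop_apply]])
  qed
  show "isCont dK a"
    unfolding continuous_at_eps_delta
  proof (intro allI impI)
    fix e :: real assume e: "e > 0"
    \<comment> \<open>The added 1 keeps the divisor in \<open>e / L\<close> positive when
      \<open>M = 0\<close>.\<close>
    define L where "L = 2 * M / r + 1"
    have L: "L > 0" "2 * M / r \<le> L" using r M0 by (auto simp: L_def add_nonneg_pos)
    have "dist (dK w) (dK a) < e" if "dist w a < min r (e / L)" for w
    proof -
      have "norm (dK w - dK a) \<le> 2 * M / r * cmod (w - a)"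
        using that by (intro est) (auto simp: dist_commute)
      also have "\<dots> \<le> L * cmod (w - a)" using L by (intro mult_right_mono) auto
      also have "\<dots> < e" using that L by (simp add: dist_norm field_simps)
      finally show ?thesis by (simp add: dist_norm)
    qed
    then show "\<exists>d>0. \<forall>w. dist w a < d \<longrightarrow> dist (dK w) (dK a) < e"
      using r e L by (intro exI[of _ "min r (e / L)"]) auto
  qed
qed


section \<open>Resolvents\<close>

text \<open>\<open>bop_inverse\<close> is a definite description: the resolvent set supplies a
  two-sided inverse \<open>R\<close>, and any left inverse \<open>S\<close> of \<open>?T\<close>
  equals \<open>S ?T R = R\<close>.\<close>

lemma bop_inverse_resolvent:
  assumes "\<mu> \<notin> bop_spectrum Z"
  shows "bop_inverse (Z - \<mu> *\<^sub>C bop_id) o\<^sub>B (Z - \<mu> *\<^sub>C bop_id) = bop_id"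
    and "(Z - \<mu> *\<^sub>C bop_id) o\<^sub>B bop_inverse (Z - \<mu> *\<^sub>C bop_id) = bop_id"
proof -
  let ?T = "Z - \<mu> *\<^sub>C bop_id"
  obtain R where R: "\<And>y. bop_apply Z (bop_apply R y) - \<mu> *\<^sub>C bop_apply R y = y"
    "\<And>x. bop_apply R (bop_apply Z x - \<mu> *\<^sub>C x) = x"
    using assms unfolding spectrum_def resolvent_set_def by auto
  have inv: "R o\<^sub>B ?T = bop_id" "?T o\<^sub>B R = bop_id"
    by (rule bop_eqI, simp add: bop.diff_left bop_apply_scaleC_left R)+
  have uniq: "S = R" if "S o\<^sub>B ?T = bop_id" for S
  proof (rule bop_eqI)
    fix x
    have "bop_apply S x = bop_apply S (bop_apply (?T o\<^sub>B R) x)" by (simp only: inv bop_apply_id)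
    also have "\<dots> = bop_apply (S o\<^sub>B ?T) (bop_apply R x)" by simp
    finally show "bop_apply S x = bop_apply R x" by (simp only: that bop_apply_id)
  qed
  have "bop_inverse ?T = R"
    unfolding bop_inverse_def
    by (rule the_equality, rule conjI[OF inv], erule conjE, rule uniq)
  with inv show "bop_inverse ?T o\<^sub>B ?T = bop_id" "?T o\<^sub>B bop_inverse ?T = bop_id" by simp_all
qed

lemma bop_apply_bop_inverse:
  assumes "\<mu> \<notin> bop_spectrum Z"
  shows "bop_apply (bop_inverse (Z - \<mu> *\<^sub>C bop_id)) (bop_apply Z x - \<mu> *\<^sub>C x) = x"
    and "bop_apply Z (bop_apply (bop_inverse (Z - \<mu> *\<^sub>C bop_id)) x) -
      \<mu> *\<^sub>C bop_apply (bop_inverse (Z - \<mu> *\<^sub>C bop_id)) x = x"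
  using arg_cong[OF bop_inverse_resolvent(1)[OF assms], of "\<lambda>T. bop_apply T x"]
    arg_cong[OF bop_inverse_resolvent(2)[OF assms], of "\<lambda>T. bop_apply T x"]
  by (simp_all add: bop.diff_left bop_apply_scaleC_left)

lemma resolvent_identity:
  assumes "\<mu> \<notin> bop_spectrum Z" "\<nu> \<notin> bop_spectrum Z"
  shows "bop_inverse (Z - \<mu> *\<^sub>C bop_id) - bop_inverse (Z - \<nu> *\<^sub>C bop_id) =
    (\<mu> - \<nu>) *\<^sub>C (bop_inverse (Z - \<mu> *\<^sub>C bop_id) o\<^sub>B bop_inverse (Z - \<nu> *\<^sub>C bop_id))"
proof (rule bop_eqI)
  fix x
  let ?R = "bop_apply (bop_inverse (Z - \<mu> *\<^sub>C bop_id))"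
  let ?S = "bop_apply (bop_inverse (Z - \<nu> *\<^sub>C bop_id))"
  have "?R x = ?R (bop_apply Z (?S x) - \<nu> *\<^sub>C ?S x)"
    by (simp only: bop_apply_bop_inverse(2)[OF assms(2)])
  also have "\<dots> = ?R (bop_apply Z (?S x) - \<mu> *\<^sub>C ?S x) + (\<mu> - \<nu>) *\<^sub>C ?R (?S x)"
    by (simp add: bop.diff_right bop_apply_scaleC_right scaleC_diff_left)
  also have "\<dots> = ?S x + (\<mu> - \<nu>) *\<^sub>C ?R (?S x)"
    by (simp only: bop_apply_bop_inverse(1)[OF assms(1)])
  finally show "bop_apply (bop_inverse (Z - \<mu> *\<^sub>C bop_id) - bop_inverse (Z - \<nu> *\<^sub>C bop_id)) x =
      bop_apply ((\<mu> - \<nu>) *\<^sub>C (bop_inverse (Z - \<mu> *\<^sub>C bop_id) o\<^sub>B bop_inverse (Z - \<nu> *\<^sub>C bop_id))) x"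
    by (simp add: bop.diff_left bop_apply_scaleC_left)
qed

text \<open>The resolvent identity bounds the difference in terms of the still unknown norm at
  \<open>\<mu>\<close>. The radius \<open>1 / (2 * r)\<close> lets half of that norm be absorbed,
  which gives \<open>2 * r\<close> as a bound for it; the second radius then yields
  \<open>e\<close>.\<close>

lemma continuous_on_resolvent:
  "continuous_on (- bop_spectrum Z) (\<lambda>\<mu>. bop_inverse (Z - \<mu> *\<^sub>C bop_id))"
  unfolding continuous_on_iff
proof (intro ballI allI impI)
  fix \<nu> e assume \<nu>: "\<nu> \<in> - bop_spectrum Z" and e: "(0::real) < e"
  let ?R = "\<lambda>\<mu>. bop_inverse (Z - \<mu> *\<^sub>C bop_id)"
  define r where "r = norm (?R \<nu>) + 1"
  have r: "r > 0" "norm (?R \<nu>) \<le> r" by (auto simp: r_def add_nonneg_pos)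
  have "dist (?R \<mu>) (?R \<nu>) < e"
    if \<mu>: "\<mu> \<in> - bop_spectrum Z" and d: "dist \<mu> \<nu> < min (1 / (2 * r)) (e / (2 * r * r))" for \<mu>
  proof -
    have "norm (?R \<mu> - ?R \<nu>) \<le> cmod (\<mu> - \<nu>) * (norm (?R \<mu>) * norm (?R \<nu>))"
      using resolvent_identity[of \<mu> Z \<nu>] \<mu> \<nu>
      by (simp add: norm_scaleC mult_left_mono norm_bop_compose)
    also have "\<dots> \<le> cmod (\<mu> - \<nu>) * (norm (?R \<mu>) * r)"
      using r by (intro mult_left_mono) auto
    finally have le: "norm (?R \<mu> - ?R \<nu>) \<le> cmod (\<mu> - \<nu>) * r * norm (?R \<mu>)"
      by (simp add: mult_ac)
    also have "\<dots> \<le> 1 / 2 * norm (?R \<mu>)"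
      using d r by (intro mult_right_mono) (auto simp: dist_norm field_simps)
    finally have "norm (?R \<mu>) \<le> 2 * r"
      using r(2) norm_triangle_sub[of "?R \<mu>" "?R \<nu>"] by linarith
    then have "cmod (\<mu> - \<nu>) * r * norm (?R \<mu>) \<le> cmod (\<mu> - \<nu>) * r * (2 * r)"
      using r by (intro mult_left_mono) auto
    also have "\<dots> < e" using d r by (simp add: dist_norm field_simps)
    finally show ?thesis using le by (simp add: dist_norm)
  qed
  then show "\<exists>d>0. \<forall>\<mu>\<in>- bop_spectrum Z. dist \<mu> \<nu> < d \<longrightarrow> dist (?R \<mu>) (?R \<nu>) < e"
    using r e by (intro exI[of _ "min (1 / (2 * r)) (e / (2 * r * r))"]) auto
qed

lemma resolvent_decay:
  fixes Z :: "'a::complex_normed_vector \<Rightarrow>\<^sub>B 'a"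
  assumes "\<And>t. t \<ge> \<beta> \<Longrightarrow> complex_of_real t \<notin> bop_spectrum Z"
  obtains c where "\<And>t. t \<ge> \<beta> \<Longrightarrow>
    norm (bop_inverse (Z - complex_of_real t *\<^sub>C bop_id)) * (1 + \<bar>t\<bar>) \<le> c"
proof -
  let ?R = "\<lambda>t. bop_inverse (Z - complex_of_real t *\<^sub>C bop_id)"
  \<comment> \<open>Beyond this threshold \<open>t - norm Z\<close> is at least
    \<open>(1 + \<bar>t\<bar>) / 2\<close>. What remains of the half-line is compact and is handled
    by continuity.\<close>
  define N where "N = 2 * norm Z + 1"
  have large: "norm (?R t) * (1 + \<bar>t\<bar>) \<le> 2" if "t \<ge> \<beta>" "t \<ge> N" for t
  proof -
    have t: "t > norm Z" "t - norm Z \<ge> (1 + \<bar>t\<bar>) / 2"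
      using that norm_ge_zero[of Z] by (simp_all add: N_def del: norm_ge_zero)
    have "norm (?R t) \<le> 1 / (t - norm Z)"
    proof (rule norm_bop_bound)
      fix x
      let ?y = "bop_apply (?R t) x"
      have "x + complex_of_real t *\<^sub>C ?y = bop_apply Z ?y"
        using bop_apply_bop_inverse(2)[OF assms[OF that(1)], of x] by (simp add: algebra_simps)
      then have "complex_of_real t *\<^sub>C ?y = bop_apply Z ?y - x"
        by (metis add_diff_cancel_left')
      then have "norm (complex_of_real t *\<^sub>C ?y) \<le> norm (bop_apply Z ?y) + norm x"
        using norm_triangle_ineq4[of "bop_apply Z ?y" x] by simp
      then have "t * norm ?y \<le> norm (bop_apply Z ?y) + norm x"
        using t norm_ge_zero[of Z] by (simp add: norm_scaleC del: norm_ge_zero)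
      then have "(t - norm Z) * norm ?y \<le> norm x"
        using norm_bop_apply[of Z ?y] by (simp add: algebra_simps)
      then show "norm ?y \<le> 1 / (t - norm Z) * norm x"
        using t by (simp add: field_simps)
    qed (use t in simp)
    then have "norm (?R t) * (t - norm Z) \<le> 1"
      using t by (simp add: field_simps)
    moreover have "norm (?R t) * ((1 + \<bar>t\<bar>) / 2) \<le> norm (?R t) * (t - norm Z)"
      using t by (intro mult_left_mono) auto
    ultimately show ?thesis by simp
  qed
  have "continuous_on {\<beta>..N} (\<lambda>t. norm (?R t) * (1 + \<bar>t\<bar>))"
    using assms
    by (intro continuous_intros continuous_on_compose2[OF continuous_on_resolvent]) auto
  then have "bounded ((\<lambda>t. norm (?R t) * (1 + \<bar>t\<bar>)) ` {\<beta>..N})"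
    by (intro compact_imp_bounded compact_continuous_image) auto
  then obtain b where "\<forall>t\<in>{\<beta>..N}. \<bar>norm (?R t) * (1 + \<bar>t\<bar>)\<bar> \<le> b"
    by (auto simp: bounded_iff)
  then have b: "norm (?R t) * (1 + \<bar>t\<bar>) \<le> b" if "t \<in> {\<beta>..N}" for t
    using that abs_le_D1 by blast
  show ?thesis
  proof (rule that)
    fix t assume "t \<ge> \<beta>"
    then show "norm (?R t) * (1 + \<bar>t\<bar>) \<le> max b 2"
      using large[of t] b[of t] by (cases "t \<le> N") (auto simp: le_max_iff_disj)
  qed
qed

text \<open>By the Cauchy criterion over growing boxes: between nested boxes, the integral of
  \<open>F\<close> changes by no more in norm than that of \<open>w\<close>, so the criterion passes
  from \<open>w\<close> to \<open>F\<close>.\<close>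

lemma continuous_dominated_integrable_on_atLeast:
  fixes F :: "real \<Rightarrow> 'b::banach" and w :: "real \<Rightarrow> real"
  assumes cont: "continuous_on {b..} F" and w: "w integrable_on {b..}"
    and le: "\<And>t. t \<ge> b \<Longrightarrow> norm (F t) \<le> w t"
  shows "F integrable_on {b..}"
proof -
  let ?F = "\<lambda>x. if x \<in> {b..} then F x else 0" and ?w = "\<lambda>x. if x \<in> {b..} then w x else 0"
  note w' = iffD1[OF integrable_alt_subset w]
  have w_int: "?w integrable_on cbox p q" for p q
    by (rule conjunct1[OF w', rule_format])
  have F_int: "?F integrable_on cbox p q" for p q
  proof -
    have "F integrable_on {max b p..q}"
      by (intro integrable_continuous_real continuous_on_subset[OF cont]) auto
    moreover have "{b..} \<inter> cbox p q = {max b p..q}" by auto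
    ultimately show ?thesis by (simp only: integrable_restrict_Int)
  qed
  have diff_le: "norm (integral (cbox p q) ?F - integral (cbox r s) ?F) \<le>
      norm (integral (cbox p q) ?w - integral (cbox r s) ?w)"
    if sub: "cbox p q \<subseteq> cbox r s" for p q r s
  proof -
    have restrict: "integral (cbox p q) f = integral (cbox r s) (\<lambda>x. if x \<in> cbox p q then f x else 0)"
      for f :: "real \<Rightarrow> 'z::banach"
      using sub by (simp only: integral_restrict_Int Int_absorb2)
    have restrict_int: "(\<lambda>x. if x \<in> cbox p q then f x else 0) integrable_on cbox r s"
      if "f integrable_on cbox p q" for f :: "real \<Rightarrow> 'z::banach"
      using sub that by (simp only: integrable_restrict_Int Int_absorb2)
    have diff: "integral (cbox r s) f - integral (cbox p q) f =
        integral (cbox r s) (\<lambda>x. f x - (if x \<in> cbox p q then f x else 0))"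
      "(\<lambda>x. f x - (if x \<in> cbox p q then f x else 0)) integrable_on cbox r s"
      if "f integrable_on cbox p q" "f integrable_on cbox r s" for f :: "real \<Rightarrow> 'z::banach"
      using restrict_int[OF that(1)] that(2)
      by (simp_all only: restrict[of f] integral_diff integrable_diff)
    have "norm (integral (cbox r s) ?F - integral (cbox p q) ?F) \<le>
        integral (cbox r s) ?w - integral (cbox p q) ?w"
      unfolding diff(1)[OF F_int F_int] diff(1)[OF w_int w_int]
      by (rule integral_norm_bound_integral[OF diff(2)[OF F_int F_int] diff(2)[OF w_int w_int]])
        (use le in auto)
    then show ?thesis by (simp add: norm_minus_commute)
  qed
  show ?thesis
  proof (rule iffD2[OF integrable_alt_subset], intro conjI allI impI, rule F_int)
    fix e :: real assume "e > 0"
    define W where "W p q = integral (cbox p q) ?w" for p q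
    define G where "G p q = integral (cbox p q) ?F" for p q
    have "\<exists>B>0. \<forall>p q r s. ball 0 B \<subseteq> cbox p q \<and> cbox p q \<subseteq> cbox r s \<longrightarrow> norm (W p q - W r s) < e"
      unfolding W_def by (rule conjunct2[OF w', rule_format, OF \<open>e > 0\<close>])
    moreover have "norm (G p q - G r s) \<le> norm (W p q - W r s)" if "cbox p q \<subseteq> cbox r s" for p q r s
      unfolding G_def W_def using that by (rule diff_le)
    ultimately have
      "\<exists>B>0. \<forall>p q r s. ball 0 B \<subseteq> cbox p q \<and> cbox p q \<subseteq> cbox r s \<longrightarrow> norm (G p q - G r s) < e"
      by (meson order_le_less_trans)
    then show "\<exists>B>0. \<forall>p q r s. ball 0 B \<subseteq> cbox p q \<and> cbox p q \<subseteq> cbox r s \<longrightarrow>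
        norm (integral (cbox p q) ?F - integral (cbox r s) ?F) < e"
      unfolding G_def .
  qed
qed


section \<open>Contour integrals at an eigenvector\<close>

text \<open>The operator integrands agree only at \<open>u\<close>, so evaluation is moved inside
  each of the four integrals. \<open>eq\<close> ranges over all \<open>T\<close> in order to serve
  both \<open>dK\<close> and \<open>dKr\<close>.\<close>

lemma bop_apply_contour_integral_op_eqI:
  assumes "has_path_integral (\<lambda>\<mu>. F \<mu> (dK \<mu>)) I g" "has_path_integral (\<lambda>\<mu>. G \<mu> (dK \<mu>)) J g"
    and "(\<lambda>t. F (complex_of_real t) (dKr t)) integrable_on {\<beta>..}"
    and "(\<lambda>t. G (complex_of_real t) (dKr t)) integrable_on {\<beta>..}"
    and eq: "\<And>\<mu> T. \<mu> \<in> contour g \<beta> \<Longrightarrow> bop_apply (F \<mu> T) u = bop_apply (G \<mu> T) u"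
  shows "bop_apply (contour_integral_op g \<beta> dK dKr F) u =
    bop_apply (contour_integral_op g \<beta> dK dKr G) (u :: 'a::complex_hilbert_space)"
proof -
  have path: "bop_apply (path_integral g (\<lambda>\<mu>. F \<mu> (dK \<mu>))) u =
      bop_apply (path_integral g (\<lambda>\<mu>. G \<mu> (dK \<mu>))) u"
  proof (rule has_path_integral_unique)
    show "has_path_integral (\<lambda>\<mu>. bop_apply (F \<mu> (dK \<mu>)) u)
        (bop_apply (path_integral g (\<lambda>\<mu>. F \<mu> (dK \<mu>))) u) g"
      by (rule has_path_integral_bop_apply[OF has_path_integral_path_integral[OF assms(1)]])
    show "has_path_integral (\<lambda>\<mu>. bop_apply (F \<mu> (dK \<mu>)) u)
        (bop_apply (path_integral g (\<lambda>\<mu>. G \<mu> (dK \<mu>))) u) g"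
      by (rule has_path_integral_cong[OF _
            has_path_integral_bop_apply[OF has_path_integral_path_integral[OF assms(2)]]])
        (simp add: eq contour_def)
  qed
  have tail: "integral {\<beta>..} (\<lambda>t. bop_apply (H t) u) = bop_apply (integral {\<beta>..} H) u"
    if "H integrable_on {\<beta>..}" for H :: "real \<Rightarrow> 'a \<Rightarrow>\<^sub>B 'a"
    using integral_linear[OF that bop.bounded_linear_left[of u]] by (simp add: o_def)
  have "integral {\<beta>..} (\<lambda>t. bop_apply (F (complex_of_real t) (dKr t)) u) =
      integral {\<beta>..} (\<lambda>t. bop_apply (G (complex_of_real t) (dKr t)) u)"
    by (rule integral_cong) (simp add: eq contour_def)
  then show ?thesis
    by (simp add: contour_integral_op_def bop.add_left path tail[OF assms(3)] tail[OF assms(4)])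
qed

lemma bop_apply_eigenvector_resolvent:
  assumes "bop_apply Z u = z *\<^sub>C u" "\<mu> \<notin> bop_spectrum Z" "z \<noteq> \<mu>"
  shows "bop_apply (T o\<^sub>B Z o\<^sub>B bop_inverse (Z - \<mu> *\<^sub>C bop_id)) u = bop_apply ((z / (z - \<mu>)) *\<^sub>C T) u"
proof -
  let ?R = "bop_apply (bop_inverse (Z - \<mu> *\<^sub>C bop_id))"
  have "u = ?R ((z - \<mu>) *\<^sub>C u)"
    using bop_apply_bop_inverse(1)[OF assms(2), of u] by (simp add: assms(1) scaleC_diff_left)
  then have "(1 / (z - \<mu>)) *\<^sub>C u = (1 / (z - \<mu>)) *\<^sub>C ((z - \<mu>) *\<^sub>C ?R u)"
    by (simp add: bop_apply_scaleC_right)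
  also have "\<dots> = ?R u"
    using assms(3) scaleC_of_real[of 1 "?R u"] by (simp add: scaleC_scaleC)
  finally have R: "?R u = (1 / (z - \<mu>)) *\<^sub>C u" by simp
  show ?thesis
    by (simp add: R assms(1) bop_apply_scaleC_right bop_apply_scaleC_left scaleC_scaleC)
qed

lemma eigenvalue_in_bop_spectrum:
  assumes "bop_apply Z u = z *\<^sub>C u" "u \<noteq> 0"
  shows "z \<in> bop_spectrum Z"
proof (rule ccontr)
  assume "z \<notin> bop_spectrum Z"
  from bop_apply_bop_inverse(1)[OF this, of u] show False
    using assms by (simp add: bop.zero_right)
qed

text \<open>No point is closer than half of \<open>cmod (a - b)\<close> to both \<open>a\<close> and
  \<open>b\<close>, and the power decreases with the distance. The bounds are conditional because
  \<open>0 powr \<gamma>\<close> is 0, not infinite.\<close>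

lemma norm_le_of_two_powr_bounds:
  fixes \<mu> a b :: complex
  assumes "\<gamma> \<le> 0" "c \<ge> 0" "a \<noteq> b"
    and "\<mu> \<noteq> a \<Longrightarrow> x \<le> c * cmod (\<mu> - a) powr \<gamma>" "\<mu> \<noteq> b \<Longrightarrow> x \<le> c * cmod (\<mu> - b) powr \<gamma>"
  shows "x \<le> c * (cmod (a - b) / 2) powr \<gamma>"
proof -
  have ab: "cmod (a - b) > 0" using assms(3) by simp
  have far: "x \<le> c * (cmod (a - b) / 2) powr \<gamma>"
    if "cmod (\<mu> - p) \<ge> cmod (a - b) / 2" "x \<le> c * cmod (\<mu> - p) powr \<gamma>" for p
  proof -
    have "cmod (\<mu> - p) powr \<gamma> \<le> (cmod (a - b) / 2) powr \<gamma>"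
      using that(1) ab assms(1) by (intro powr_mono2') auto
    then show ?thesis
      using that(2) mult_left_mono[OF _ assms(2)] by (meson order_trans)
  qed
  have "cmod (a - b) \<le> cmod (\<mu> - a) + cmod (\<mu> - b)"
    using norm_triangle_ineq4[of "\<mu> - b" "\<mu> - a"] by simp
  then consider "cmod (\<mu> - a) \<ge> cmod (a - b) / 2" | "cmod (\<mu> - b) \<ge> cmod (a - b) / 2" by linarith
  then show ?thesis
  proof cases
    case 1
    then have "\<mu> \<noteq> a" using ab by auto
    from far[OF 1 assms(4)[OF this]] show ?thesis .
  next
    case 2
    then have "\<mu> \<noteq> b" using ab by auto
    from far[OF 2 assms(5)[OF this]] show ?thesis .
  qed
qed

text \<open>A general bilinear \<open>prod\<close> covers both composition with the resolvent and
  multiplication by a scalar.\<close>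

lemma path_integral_multiplier_exists:
  fixes g :: "real \<Rightarrow> complex" and dK :: "complex \<Rightarrow> 'b::complex_normed_vector"
    and m :: "complex \<Rightarrow> 'd::real_normed_vector" and prod :: "'b \<Rightarrow> 'd \<Rightarrow> 'e::complex_banach"
  assumes prod: "bounded_bilinear prod"
    and g: "rectifiable_path g" and D: "g ` {0<..<1} \<subseteq> \<D>"
    and dK: "continuous_on \<D> dK" and M: "\<And>\<mu>. \<mu> \<in> \<D> \<Longrightarrow> norm (dK \<mu>) \<le> M"
    and m: "continuous_on (path_image g) m"
  shows "\<exists>I. has_path_integral (\<lambda>\<mu>. prod (dK \<mu>) (m \<mu>)) I g"
proof -
  obtain k where k: "k \<ge> 0" "\<And>x y. norm (prod x y) \<le> norm x * norm y * k"
    using bounded_bilinear.nonneg_bounded[OF prod] by blast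
  have path: "path g" using g by (simp add: rectifiable_path_def)
  have "bounded (m ` path_image g)"
    using m compact_path_image[OF path] by (intro compact_imp_bounded compact_continuous_image)
  then obtain N where N: "\<And>\<mu>. \<mu> \<in> path_image g \<Longrightarrow> norm (m \<mu>) \<le> N"
    by (auto simp: bounded_iff)
  \<comment> \<open>The values at the two end points enter separately, since \<open>M\<close> bounds
    \<open>dK\<close> only on \<open>\<D>\<close>.\<close>
  define M' where "M' = max (max 0 M) (max (norm (dK (g 0))) (norm (dK (g 1))))"
  have M': "norm (dK (g t)) \<le> M'" if t: "t \<in> {0..1}" for t
  proof -
    consider "t = 0" | "t = 1" | "t \<in> {0<..<1}" using t by fastforce
    then show ?thesis
    proof cases
      case 3
      then have "norm (dK (g t)) \<le> M" using D by (intro M) blast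
      then show ?thesis by (simp add: M'_def)
    qed (simp_all add: M'_def)
  qed
  have gc: "continuous_on {0..1} g" using path by (simp add: path_def)
  show ?thesis
  proof (rule has_path_integral_exists[OF g])
    show "continuous_on {0<..<1} (\<lambda>t. prod (dK (g t)) (m (g t)))"
    proof (rule bounded_bilinear.continuous_on[OF prod])
      have g': "continuous_on {0<..<1} g"
        using gc by (rule continuous_on_subset) auto
      show "continuous_on {0<..<1} (\<lambda>t. dK (g t))"
        by (rule continuous_on_compose2[OF dK g' D])
      show "continuous_on {0<..<1} (\<lambda>t. m (g t))"
        by (rule continuous_on_compose2[OF m g']) (auto simp: path_image_def)
    qed
    fix t :: real assume t: "t \<in> {0..1}"
    then have "norm (m (g t)) \<le> N" by (intro N) (simp add: path_image_def)
    then have "norm (dK (g t)) * norm (m (g t)) \<le> M' * N"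
      using M'[OF t] by (intro mult_mono) (auto simp: M'_def)
    then have "norm (dK (g t)) * norm (m (g t)) * k \<le> M' * N * k"
      using k(1) by (rule mult_right_mono)
    then show "norm (prod (dK (g t)) (m (g t))) \<le> M' * N * k"
      using k(2)[of "dK (g t)" "m (g t)"] by linarith
  qed
qed

text \<open>The decay of the multiplier supplies the weight \<open>1 / (1 + \<bar>t\<bar>)\<close>
  with which \<open>dKr\<close> is integrable.\<close>

lemma multiplier_integrable_on_atLeast:
  fixes dKr :: "real \<Rightarrow> 'b::real_normed_vector"
    and m :: "real \<Rightarrow> 'd::real_normed_vector" and prod :: "'b \<Rightarrow> 'd \<Rightarrow> 'e::banach"
  assumes prod: "bounded_bilinear prod"
    and dKr: "continuous_on {\<beta>..} dKr" "(\<lambda>t. norm (dKr t) / (1 + \<bar>t\<bar>)) integrable_on {\<beta>..}"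
    and m: "continuous_on {\<beta>..} m" "\<And>t. t \<ge> \<beta> \<Longrightarrow> norm (m t) * (1 + \<bar>t\<bar>) \<le> N"
  shows "(\<lambda>t. prod (dKr t) (m t)) integrable_on {\<beta>..}"
proof -
  obtain k where k: "k \<ge> 0" "\<And>x y. norm (prod x y) \<le> norm x * norm y * k"
    using bounded_bilinear.nonneg_bounded[OF prod] by blast
  show ?thesis
  proof (rule continuous_dominated_integrable_on_atLeast)
    show "continuous_on {\<beta>..} (\<lambda>t. prod (dKr t) (m t))"
      by (rule bounded_bilinear.continuous_on[OF prod dKr(1) m(1)])
    show "(\<lambda>t. N * k * (norm (dKr t) / (1 + \<bar>t\<bar>))) integrable_on {\<beta>..}"
      using integrable_cmul[OF dKr(2), of "N * k"] by simp
    fix t assume t: "t \<ge> \<beta>"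
    have "norm (m t) \<le> N / (1 + \<bar>t\<bar>)"
      using m(2)[OF t] by (simp add: field_simps add_pos_nonneg)
    then have "norm (dKr t) * norm (m t) * k \<le> norm (dKr t) * (N / (1 + \<bar>t\<bar>)) * k"
      using k(1) by (intro mult_right_mono mult_left_mono) auto
    then show "norm (prod (dKr t) (m t)) \<le> N * k * (norm (dKr t) / (1 + \<bar>t\<bar>))"
      using k(2)[of "dKr t" "m t"] by (simp add: mult_ac)
  qed
qed

text \<open>The scalar counterpart of \<open>resolvent_decay\<close>, with an explicit constant from
  \<open>\<bar>t\<bar> \<le> cmod z + cmod (z - t)\<close>.\<close>

lemma one_plus_abs_div_le:
  assumes "d > 0" "cmod (z - complex_of_real t) \<ge> d"
  shows "cmod (1 / (z - complex_of_real t)) * (1 + \<bar>t\<bar>) \<le> 1 + (1 + cmod z) / d"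
proof -
  let ?w = "cmod (z - complex_of_real t)"
  have "\<bar>t\<bar> \<le> cmod z + ?w"
    using norm_triangle_ineq4[of z "z - complex_of_real t"] by simp
  then have "(1 + \<bar>t\<bar>) / ?w \<le> (?w + (1 + cmod z)) / ?w"
    by (intro divide_right_mono) auto
  also have "\<dots> = 1 + (1 + cmod z) / ?w"
    using assms by (subst add_divide_distrib) auto
  also have "\<dots> \<le> 1 + (1 + cmod z) / d"
    using assms by (intro add_left_mono divide_left_mono mult_pos_pos) auto
  finally show ?thesis by (simp add: norm_divide)
qed

lemma transfer_V_right_eigenvector:
  fixes Z :: "'a::complex_hilbert_space \<Rightarrow>\<^sub>B 'a"
  assumes g: "rectifiable_path g" "g ` {0<..<1} \<subseteq> \<D>"
    and dK: "continuous_on \<D> dK" "\<And>\<mu>. \<mu> \<in> \<D> \<Longrightarrow> norm (dK \<mu>) \<le> M"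
    and dKr: "continuous_on {\<beta>..} dKr" "(\<lambda>t. norm (dKr t) / (1 + \<bar>t\<bar>)) integrable_on {\<beta>..}"
    and dist: "setdist (bop_spectrum Z) (contour g \<beta>) > 0"
    and u: "u \<noteq> 0" "bop_apply Z u = z *\<^sub>C u"
  shows "bop_apply (transfer_V_right g \<beta> dK dKr Z) u = bop_apply (transfer_V g \<beta> dK dKr z) u"
    and "z \<notin> contour g \<beta>"
proof -
  define d where "d = setdist (bop_spectrum Z) (contour g \<beta>)"
  have z: "z \<in> bop_spectrum Z" by (rule eigenvalue_in_bop_spectrum[OF u(2,1)])
  have d: "d > 0" "\<And>\<zeta> \<mu>. \<zeta> \<in> bop_spectrum Z \<Longrightarrow> \<mu> \<in> contour g \<beta> \<Longrightarrow> cmod (\<zeta> - \<mu>) \<ge> d"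
    using dist setdist_le_dist[of _ "bop_spectrum Z" _ "contour g \<beta>"]
    by (auto simp: d_def dist_norm)
  \<comment> \<open>A common point of spectrum and contour would be at distance 0 from itself; as
    \<open>z\<close> lies in the spectrum, it is off the contour too.\<close>
  have off: "\<mu> \<notin> bop_spectrum Z" "z \<noteq> \<mu>" if "\<mu> \<in> contour g \<beta>" for \<mu>
    using d(1) d(2)[of \<mu> \<mu>] d(2)[OF z that] that by auto
  then show "z \<notin> contour g \<beta>" by blast
  have path: "path_image g \<subseteq> contour g \<beta>" and ray: "\<And>t. t \<ge> \<beta> \<Longrightarrow> complex_of_real t \<in> contour g \<beta>"
    by (auto simp: contour_def)
  have mult: "bounded_bilinear (\<lambda>T R. T o\<^sub>B Z o\<^sub>B R)"
    by (rule bounded_bilinear.comp1[OF bounded_bilinear_bop_compose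
          bounded_bilinear.bounded_linear_left[OF bounded_bilinear_bop_compose]])
  \<comment> \<open>The factor \<open>z\<close> is absorbed into the product, as \<open>Z\<close> is
    in \<open>mult\<close>, leaving \<open>1 / (z - \<mu>)\<close> in the place of the
    resolvent.\<close>
  have scale: "bounded_bilinear (\<lambda>(T :: 'a \<Rightarrow>\<^sub>B 'a) c. (z * c) *\<^sub>C T)"
    by (rule bounded_bilinear.flip[OF bounded_bilinear.comp1[OF bounded_bilinear_scaleC
          bounded_linear_mult_right]])
  have resolvent: "continuous_on (contour g \<beta>) (\<lambda>\<mu>. bop_inverse (Z - \<mu> *\<^sub>C bop_id))"
    by (rule continuous_on_subset[OF continuous_on_resolvent]) (use off in auto)
  have scalar: "continuous_on (contour g \<beta>) (\<lambda>\<mu>. 1 / (z - \<mu>))"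
    by (intro continuous_intros) (use off in auto)
  obtain N where N: "\<And>t. t \<ge> \<beta> \<Longrightarrow>
      norm (bop_inverse (Z - complex_of_real t *\<^sub>C bop_id)) * (1 + \<bar>t\<bar>) \<le> N"
    using resolvent_decay[of \<beta> Z] off(1)[OF ray] by metis
  have on_ray: "continuous_on {\<beta>..} (\<lambda>t. m (complex_of_real t))"
    if "continuous_on (contour g \<beta>) m" for m :: "complex \<Rightarrow> 'z::real_normed_vector"
    by (rule continuous_on_compose2[OF that]) (auto intro!: continuous_intros ray)
  have path1: "\<exists>I. has_path_integral (\<lambda>\<mu>. dK \<mu> o\<^sub>B Z o\<^sub>B bop_inverse (Z - \<mu> *\<^sub>C bop_id)) I g"
    by (rule path_integral_multiplier_exists[OF mult g dK continuous_on_subset[OF resolvent path]])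
  have path2: "\<exists>I. has_path_integral (\<lambda>\<mu>. (z * (1 / (z - \<mu>))) *\<^sub>C dK \<mu>) I g"
    by (rule path_integral_multiplier_exists[OF scale g dK continuous_on_subset[OF scalar path]])
  have tail1: "(\<lambda>t. dKr t o\<^sub>B Z o\<^sub>B bop_inverse (Z - complex_of_real t *\<^sub>C bop_id)) integrable_on {\<beta>..}"
    by (rule multiplier_integrable_on_atLeast[OF mult dKr on_ray[OF resolvent] N])
  have tail2: "(\<lambda>t. (z * (1 / (z - complex_of_real t))) *\<^sub>C dKr t) integrable_on {\<beta>..}"
    by (rule multiplier_integrable_on_atLeast[OF scale dKr on_ray[OF scalar]
          one_plus_abs_div_le[OF d(1) d(2)[OF z ray]]])
  from path1 path2 obtain I J where
    "has_path_integral (\<lambda>\<mu>. dK \<mu> o\<^sub>B Z o\<^sub>B bop_inverse (Z - \<mu> *\<^sub>C bop_id)) I g"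
    "has_path_integral (\<lambda>\<mu>. (z / (z - \<mu>)) *\<^sub>C dK \<mu>) J g"
    by auto
  then show "bop_apply (transfer_V_right g \<beta> dK dKr Z) u = bop_apply (transfer_V g \<beta> dK dKr z) u"
    unfolding transfer_V_right_def transfer_V_def
  proof (rule bop_apply_contour_integral_op_eqI)
    show "(\<lambda>t. (z / (z - complex_of_real t)) *\<^sub>C dKr t) integrable_on {\<beta>..}"
      using tail2 by simp
    show "bop_apply (T o\<^sub>B Z o\<^sub>B bop_inverse (Z - \<mu> *\<^sub>C bop_id)) u =
        bop_apply ((z / (z - \<mu>)) *\<^sub>C T) u" if "\<mu> \<in> contour g \<beta>" for \<mu> and T :: "'a \<Rightarrow>\<^sub>B 'a"
      by (rule bop_apply_eigenvector_resolvent[OF u(2) off[OF that]])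
  qed (fact tail1)
qed

theorem mainTheorem4:
  fixes A At Z :: "'a::complex_hilbert_space \<Rightarrow>\<^sub>B 'a"
    and C :: "'c::complex_hilbert_space \<Rightarrow> 'c"
    and D :: "'a \<Rightarrow> 'c"
    and B :: "'c \<Rightarrow> 'a"
    and E :: "real \<Rightarrow> 'c \<Rightarrow>\<^sub>B 'c"
    and C_inv_sqrt :: "'c \<Rightarrow>\<^sub>B 'c"
    and Dt :: "'a \<Rightarrow>\<^sub>B 'c"
    and Bt :: "'c \<Rightarrow>\<^sub>B 'a"
    and K dK :: "complex \<Rightarrow> 'a \<Rightarrow>\<^sub>B 'a"
    and dKr :: "real \<Rightarrow> 'a \<Rightarrow>\<^sub>B 'a"
    and domC domB :: "'c set" and domD :: "'a set"
    and \<D> :: "complex set" and g :: "real \<Rightarrow> complex"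
    and lamC \<alpha>1 \<alpha>2 \<eta> \<beta> c \<gamma> :: real and l :: int
    and z :: complex and u :: 'a
  assumes "separable_space (euclidean :: 'a topology)"
    and "separable_space (euclidean :: 'c topology)"
    \<comment> \<open>the operator \<open>C\<close>, its spectral family and \<open>C\<^sup>-\<^sup>1\<^sup>/\<^sup>2\<close>\<close>
    and "self_adjoint_op domC C"
    and "lamC > 0"
    and "\<forall>x\<in>domC. Re (cinner (C x) x) \<ge> lamC * (norm x)\<^sup>2"
    and "spectrum domC C = complex_of_real ` {lamC..}"
    and "spectral_family_of E domC C"
    and "\<forall>x. absolutely_continuous lborel (spectral_measure E x)"
    and "is_spectral_integral E (\<lambda>\<mu>. 1 / sqrt \<mu>) UNIV (bop_apply C_inv_sqrt)"
    \<comment> \<open>the operators \<open>D\<close> and \<open>B\<close>, and the bounded operators built from them\<close>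
    and "densely_defined_op domD D" and "closable_op domD D"
    and "\<forall>x\<in>domD. bop_apply Dt x = bop_apply C_inv_sqrt (D x)"
    and "densely_defined_op domB B" and "closable_op domB B"
    and "spectral_domain E sqrt \<subseteq> domB"
    and "\<forall>y. bop_apply Bt y = B (bop_apply C_inv_sqrt y)"
    and At_def: "At = A - Bt o\<^sub>B Dt"
    \<comment> \<open>the numerical range\<close>
    and "\<eta> > 0" and "\<alpha>1 < \<alpha>2" and "\<alpha>1 - \<eta> > lamC"
    and "numerical_range At \<subseteq> segment_nbhd \<eta> \<alpha>1 \<alpha>2"
    \<comment> \<open>the function \<open>K\<close> on the real axis\<close>
    and "\<forall>\<mu>>lamC. ((\<lambda>\<nu>. Bt o\<^sub>B E \<nu> o\<^sub>B Dt) has_vector_derivative dKr \<mu>) (at \<mu>)"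
    and "continuous_on {lamC<..} dKr"
    \<comment> \<open>its analytic continuation to \<open>\<D>\<close>\<close>
    and "\<beta> > \<alpha>2 + \<eta>"
    and "open \<D>" and "connected \<D>" and "simply_connected \<D>"
    and "segment_nbhd \<eta> \<alpha>1 \<alpha>2 \<subseteq> \<D>" and "complex_of_real ` {lamC<..<\<beta>} \<subseteq> \<D>"
    and "\<forall>\<mu>\<in>\<D>. (K has_derivative (\<lambda>h. h *\<^sub>C dK \<mu>)) (at \<mu>)"
    and "\<forall>\<mu>\<in>{lamC<..<\<beta>}. K (complex_of_real \<mu>) = Bt o\<^sub>B E \<mu> o\<^sub>B Dt"
    \<comment> \<open>bounds on its derivative\<close>
    and "c > 0" and "-1 < \<gamma>" and "\<gamma> \<le> 0"
    and "\<forall>\<nu>\<in>{lamC, \<beta>}. \<forall>\<mu>\<in>\<D> - {complex_of_real \<nu>}.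
           norm (dK \<mu>) \<le> c * cmod (\<mu> - complex_of_real \<nu>) powr \<gamma>"
    and "(\<lambda>\<mu>. norm (dKr \<mu>) / (1 + \<bar>\<mu>\<bar>)) integrable_on {\<beta>..}"
    \<comment> \<open>the contour\<close>
    and "l \<in> {1, -1}"
    and "deformed_interval \<D> l lamC \<beta> g"
    \<comment> \<open>the solution \<open>Z\<close> and an eigenvector of it\<close>
    and "setdist (bop_spectrum Z) (contour g \<beta>) > 0"
    and "Z = At + transfer_V_right g \<beta> dK dKr Z"
    and "u \<noteq> 0" and "bop_apply Z u = z *\<^sub>C u"
  shows "z \<in> bop_spectrum Z \<and>
    z *\<^sub>C u = bop_apply At u + bop_apply (transfer_V g \<beta> dK dKr z) u \<and>
    function_eigenpair (contour g \<beta>) (transfer_M At g \<beta> dK dKr) z u"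
proof -
  have \<beta>: "\<beta> > lamC"
    using \<open>\<beta> > \<alpha>2 + \<eta>\<close> \<open>\<eta> > 0\<close> \<open>\<alpha>1 < \<alpha>2\<close> \<open>\<alpha>1 - \<eta> > lamC\<close> by linarith
  define M where "M = c * (cmod (complex_of_real lamC - complex_of_real \<beta>) / 2) powr \<gamma>"
  have M: "norm (dK \<mu>) \<le> M" if \<mu>: "\<mu> \<in> \<D>" for \<mu>
  proof -
    have "norm (dK \<mu>) \<le> c * cmod (\<mu> - complex_of_real \<nu>) powr \<gamma>"
      if "\<nu> \<in> {lamC, \<beta>}" "\<mu> \<noteq> complex_of_real \<nu>" for \<nu>
      using \<open>\<forall>\<nu>\<in>{lamC, \<beta>}. \<forall>\<mu>\<in>\<D> - {complex_of_real \<nu>}.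
           norm (dK \<mu>) \<le> c * cmod (\<mu> - complex_of_real \<nu>) powr \<gamma>\<close> \<mu> that
      by blast
    then show ?thesis
      unfolding M_def using \<beta> \<open>c > 0\<close> \<open>\<gamma> \<le> 0\<close>
      by (intro norm_le_of_two_powr_bounds[where \<mu> = \<mu>]) auto
  qed
  have dK: "continuous_on \<D> dK"
    using \<open>\<forall>\<mu>\<in>\<D>. (K has_derivative (\<lambda>h. h *\<^sub>C dK \<mu>)) (at \<mu>)\<close>
    by (intro continuous_on_bounded_bop_derivative[OF \<open>open \<D>\<close> _ M]) blast+
  have g: "rectifiable_path g" "g ` {0<..<1} \<subseteq> \<D>"
    using \<open>deformed_interval \<D> l lamC \<beta> g\<close>
    unfolding deformed_interval_def half_domain_def by blast+
  \<comment> \<open>As \<open>\<beta>\<close> exceeds \<open>lamC\<close> strictly, the closed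
    half-line lies in the open one where \<open>dKr\<close> is continuous.\<close>
  have dKr: "continuous_on {\<beta>..} dKr"
    using \<open>continuous_on {lamC<..} dKr\<close> by (rule continuous_on_subset) (use \<beta> in auto)
  note V = transfer_V_right_eigenvector[OF g dK M dKr
      \<open>(\<lambda>\<mu>. norm (dKr \<mu>) / (1 + \<bar>\<mu>\<bar>)) integrable_on {\<beta>..}\<close>
      \<open>setdist (bop_spectrum Z) (contour g \<beta>) > 0\<close> \<open>u \<noteq> 0\<close> \<open>bop_apply Z u = z *\<^sub>C u\<close>]
  have "z *\<^sub>C u = bop_apply (At + transfer_V_right g \<beta> dK dKr Z) u"
    using \<open>Z = At + transfer_V_right g \<beta> dK dKr Z\<close> \<open>bop_apply Z u = z *\<^sub>C u\<close> by simp
  then have eq: "z *\<^sub>C u = bop_apply At u + bop_apply (transfer_V g \<beta> dK dKr z) u"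
    by (simp add: bop.add_left V(1))
  then have "bop_apply (transfer_M At g \<beta> dK dKr z) u = 0"
    by (simp add: transfer_M_def bop.add_left bop.diff_left bop_apply_scaleC_left)
  then show ?thesis
    using eq V(2) \<open>u \<noteq> 0\<close> eigenvalue_in_bop_spectrum[OF \<open>bop_apply Z u = z *\<^sub>C u\<close> \<open>u \<noteq> 0\<close>]
    by (simp add: function_eigenpair_def)
qed

end
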